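(* Let $q$ be a prime power, let $V$ be an $n$-dimensional vector space over the finite field $\mathbb{F}_q$, and for $m=0,\dots,n$ let $\mathcal{V}_m$ denote the set of $m$-dimensional subspaces of $V$. Let $k,\ell$ be integers with $1\leqslant k,\ell$, $n\geqslant 2k$ and $n\geqslant 2\ell$. Let $\mathscr{F}\subseteq \mathcal{V}_k$ and $\mathscr{G}\subseteq \mathcal{V}_\ell$ be families such that $x\cap y\neq 0$ for all $x\in\mathscr{F}$ and $y\in\mathscr{G}$. Then $$|\mathscr{F}|\,|\mathscr{G}|\leqslant \left[{n-1\atop k-1}\right]_q\left[{n-1\atop \ell-1}\right]_q,$$ and equality holds if and only if either (i) there is $z\in\mathcal{V}_1$ such that $\mathscr{F}=\{x\in\mathcal{V}_k : z\subseteq x\}$ and $\mathscr{G}=\{x\in\mathcal{V}_\ell : z\subseteq x\}$, or (ii) $n=2k=2\ell$ and there is $z\in\mathcal{V}_{2k-1}$ such that $\mathscr{F}=\mathscr{G}=\{x\in\mathcal{V}_k : x\subseteq z\}$.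
   Context: The Gaussian coefficient is $\left[{a\atop b}\right]_q=\prod_{i=0}^{b-1}\frac{q^{a-i}-1}{q^{b-i}-1}$ for integers $a,b\geqslant 0$. *)

theory Defs
  imports Complex_Main "HOL-Library.Cardinality"
begin

text \<open>The natural-number subtraction \<open>a - i\<close> is harmless: if \<open>i > a\<close> occurs in the product, then so does
  the factor for \<open>i = a\<close>, which is zero (as it is with integer exponents).\<close>

definition gauss_coeff :: "nat \<Rightarrow> nat \<Rightarrow> nat \<Rightarrow> real" where
  "gauss_coeff q a b = (\<Prod>i<b. (real q ^ (a - i) - 1) / (real q ^ (b - i) - 1))"

text \<open>The ambient space \<open>V\<close> is the whole type \<open>'v\<close> with scalar multiplication \<open>scale\<close>. For a
  space without a finite basis \<open>dim\<close> is \<open>0\<close> by convention, so \<open>dim UNIV = n\<close> with \<open>n > 0\<close>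
  entails finite dimension.\<close>

definition subspaces_of_dim :: "('k::field \<Rightarrow> 'v::ab_group_add \<Rightarrow> 'v) \<Rightarrow> nat \<Rightarrow> 'v set set" where
  "subspaces_of_dim scale m =
    {x. module.subspace scale x \<and> vector_space.dim scale x = m}"

end

theory Submission
  imports Defs "HOL-Analysis.L2_Norm"
begin

text \<open>Let \<open>T k l\<close> average a function on the \<open>k\<close>-spaces over those disjoint from a given \<open>l\<close>-space. A
  function on the \<open>k\<close>-spaces is an orthogonal sum of lifts of harmonic functions on the \<open>j\<close>-spaces,
  and by Moebius inversion \<open>T k l\<close> maps the degree-\<open>j\<close> lift of a harmonic function to a multiple of
  its lift to the \<open>l\<close>-spaces. The products of the corresponding multipliers for \<open>(k, l)\<close> and
  \<open>(l, k)\<close> factor as \<open>lam k j * lam l j\<close>, and \<open>lam\<close> at least halves when \<open>j\<close> increases.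
  Cross-intersection says that the indicators of \<open>F\<close> and \<open>G\<close> are orthogonal with respect to
  \<open>T k l\<close>. For \<open>k \<noteq> l\<close> the resulting Cauchy-Schwarz estimate is too weak; one also needs that the
  number of disjoint pairs inside \<open>F\<close>, and inside \<open>G\<close>, is nonnegative, which bounds their energy in
  degree one. Together these inequalities give the bound.

  In the case of equality the indicator of \<open>F\<close> has degree at most one, so it is \<open>x \<mapsto> weight \<chi> x\<close>
  for some \<open>\<chi>\<close> with total weight 1. A point on no member of \<open>F\<close> has the least possible
  weight. If such a point exists then averaging forces \<open>n = 2 * k\<close> and the union of \<open>F\<close> to be a
  subspace; if none exists then all weights are nonnegative, members of \<open>F\<close> carry the total weight,
  and so all of them contain a common point.\<close>

subsection \<open>Counting subspaces\<close>

text \<open>For \<open>j \<le> k\<close>, the number of \<open>k\<close>-spaces inside an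
  \<open>m\<close>-space that contain a given \<open>j\<close>-space and meet trivially a given
  \<open>l\<close>-space, itself disjoint from the \<open>j\<close>-space; see
  \<open>card_between_disjoint\<close>. For \<open>l = 0\<close> it is the Gaussian coefficient of
  \<open>m - j\<close> over \<open>k - j\<close>.\<close>

definition qcount :: "nat \<Rightarrow> nat \<Rightarrow> nat \<Rightarrow> nat \<Rightarrow> nat \<Rightarrow> real" where
  "qcount q m l j k = (\<Prod>i\<in>{j..<k}. (real q ^ m - real q ^ (i + l)) / (real q ^ k - real q ^ i))"

locale finite_field_space = finite_dimensional_vector_space scale Basis
  for scale :: "'k::{field,finite} \<Rightarrow> 'v::ab_group_add \<Rightarrow> 'v" and Basis :: "'v set" +
  fixes q n :: nat
  assumes q_def: "q = CARD('k)" and dim_UNIV_n: "dim UNIV = n"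
begin

abbreviation S :: "nat \<Rightarrow> 'v set set" where "S m \<equiv> subspaces_of_dim scale m"

lemma S_iff: "x \<in> S m \<longleftrightarrow> subspace x \<and> dim x = m"
  by (simp add: subspaces_of_dim_def)

lemma q_gt_1: "1 < q"
proof -
  have "card {0, 1::'k} \<le> card (UNIV :: 'k set)" by (rule card_mono) auto
  then show ?thesis by (simp add: q_def)
qed

lemma card_span_independent:
  assumes "finite B" "independent B"
  shows "finite (span B) \<and> card (span B) = q ^ card B"
  using assms
proof (induction B rule: finite_induct)
  case empty
  then show ?case by simp
next
  case (insert b B)
  let ?h = "\<lambda>(c, v). scale c b + v"
  have b: "b \<notin> span B" and B: "independent B"
    using insert.prems insert.hyps by (auto simp: independent_insert)
  have eq: "span (insert b B) = ?h ` (UNIV \<times> span B)"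
  proof (intro equalityI subsetI)
    fix v assume "v \<in> span (insert b B)"
    then obtain c where c: "v - scale c b \<in> span B" using span_breakdown_eq by blast
    then show "v \<in> ?h ` (UNIV \<times> span B)"
      by (intro image_eqI[of _ _ "(c, v - scale c b)"]) auto
  next
    fix v assume "v \<in> ?h ` (UNIV \<times> span B)"
    then obtain c w where "v = scale c b + w" "w \<in> span B" by auto
    then have "v - scale c b \<in> span B" by simp
    then show "v \<in> span (insert b B)" using span_breakdown_eq by blast
  qed
  have inj: "inj_on ?h (UNIV \<times> span B)"
  proof (rule inj_onI, clarify)
    fix c v c' v' assume v: "v \<in> span B" "v' \<in> span B" and e: "scale c b + v = scale c' b + v'"
    have d: "scale (c - c') b = v' - v" using e
      by (simp add: scale_left_diff_distrib algebra_simps)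
    have "c = c'"
    proof (rule ccontr)
      assume "c \<noteq> c'"
      moreover have "scale (c - c') b \<in> span B" using d v span_diff by simp
      ultimately have "scale (inverse (c - c')) (scale (c - c') b) \<in> span B" by (metis span_scale)
      then show False using b \<open>c \<noteq> c'\<close> by simp
    qed
    with e show "c = c' \<and> v = v'" by simp
  qed
  show ?case
    using insert.IH[OF B] insert.hyps inj
    by (simp add: eq card_image card_cartesian_product q_def)
qed

lemma finite_UNIV_space [simp]: "finite (UNIV :: 'v set)"
proof -
  have "finite (span Basis)"
    using card_span_independent[OF finite_Basis independent_Basis] by blast
  then show ?thesis unfolding span_Basis .
qed

lemma finite_space [simp]: "finite (A :: 'v set)"
  by (rule finite_subset[OF subset_UNIV finite_UNIV_space])

lemma finite_subspaces [simp]: "finite (\<A> :: 'v set set)"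
  by (rule finite_subset[OF _ iffD2[OF finite_Pow_iff finite_UNIV_space]]) auto

lemma card_subspace:
  assumes "subspace W" shows "card W = q ^ dim W"
proof -
  obtain B where "B \<subseteq> W" "independent B" "W \<subseteq> span B" "card B = dim W"
    using basis_exists by blast
  moreover from this have "span B = W" using assms span_subspace by blast
  ultimately show ?thesis using card_span_independent[of B] by simp
qed

lemma card_S: "x \<in> S m \<Longrightarrow> card x = q ^ m"
  by (auto simp: S_iff card_subspace)

lemma dim_le_n: "dim (W :: 'v set) \<le> n"
  using dim_subset[of W UNIV] dim_UNIV_n by simp

lemma span_insert_subspace:
  assumes "subspace z" "v \<notin> z"
  shows "span (insert v z) \<in> S (Suc (dim z))"
  using assms by (simp add: S_iff dim_insert span_eq_iff[THEN iffD2])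

lemma S_0: "S 0 = {{0}}"
proof -
  have "x = {0}" if "subspace x" "dim x = 0" for x
    using that card_subspace[of x] subspace_0[of x] by (auto simp: card_1_singleton_iff)
  moreover have "{0} \<in> S 0" by (simp add: S_iff subspace_single_0)
  ultimately show ?thesis by (auto simp: S_iff subspace_0)
qed

text \<open>Double counting of the pairs \<open>(v, x)\<close> with \<open>v\<close> in
  \<open>x\<close> outside \<open>z\<close>, by downward induction on \<open>j\<close>: for
  \<open>v\<close> outside \<open>z\<close>, adjoining \<open>v\<close> to \<open>z\<close> gives a
  \<open>(j + 1)\<close>-space that still misses \<open>y\<close> exactly when \<open>v\<close> lies
  outside \<open>z + y\<close>.\<close>

lemma card_between_disjoint:
  assumes "U \<in> S m" "z \<in> S j" "y \<in> S l" "z \<subseteq> U" "y \<subseteq> U" "z \<inter> y = {0}" "j \<le> k"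
  shows "real (card {x \<in> S k. z \<subseteq> x \<and> x \<subseteq> U \<and> x \<inter> y = {0}}) = qcount q m l j k"
  using assms(7,2,4,6)
proof (induction arbitrary: z rule: inc_induct)
  case base
  have "x = z" if "x \<in> S k" "z \<subseteq> x" for x
    using that base subspace_dim_equal[of z x] by (simp add: S_iff)
  then have "{x \<in> S k. z \<subseteq> x \<and> x \<subseteq> U \<and> x \<inter> y = {0}} = {z}"
    using base by auto
  then show ?case by (simp add: qcount_def)
next
  case (step j)
  let ?X = "{x \<in> S k. z \<subseteq> x \<and> x \<subseteq> U \<and> x \<inter> y = {0}}"
  let ?zy = "{a + b |a b. a \<in> z \<and> b \<in> y}"
  have sz: "subspace z" "dim z = j" "subspace y" "dim y = l" "subspace U" "dim U = m"
    using step assms by (auto simp: S_iff)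
  have szy: "subspace ?zy" using sz subspace_sums by blast
  have zyU: "?zy \<subseteq> U" using step.prems assms sz by (auto intro: subspace_add)
  have zzy: "z \<subseteq> ?zy" "y \<subseteq> ?zy"
    using sz subspace_0 by (force intro: exI[of _ 0])+
  have "dim ?zy = j + l" using dim_sums_Int[of z y] sz step.prems by simp
  then have czy: "card ?zy = q ^ (j + l)" using szy card_subspace by simp
  have cU: "card U = q ^ m" using sz card_subspace by simp
  let ?P = "{(v, x). x \<in> ?X \<and> v \<in> x - z}"
  have "real (card ?P) = (\<Sum>x\<in>?X. real (card (x - z)))"
  proof -
    have "?P = prod.swap ` (SIGMA x:?X. x - z)" by auto
    then have "card ?P = card (SIGMA x:?X. x - z)" by (simp add: card_image)
    then show ?thesis by simp
  qed
  also have "\<dots> = (\<Sum>x\<in>?X. real q ^ k - real q ^ j)"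
  proof (rule sum.cong[OF refl])
    fix x assume x: "x \<in> ?X"
    have "card (x - z) = q ^ k - q ^ j"
      using x card_S[of x k] card_S[of z j] step.prems by (simp add: card_Diff_subset)
    moreover have "q ^ j \<le> q ^ k" using step.hyps q_gt_1 by (simp add: power_increasing)
    ultimately show "real (card (x - z)) = real q ^ k - real q ^ j" by (simp add: of_nat_diff)
  qed
  finally have 1: "real (card ?P) = real (card ?X) * (real q ^ k - real q ^ j)" by simp
  have "real (card ?P) = (\<Sum>v\<in>U - ?zy. real (card {x \<in> S k. span (insert v z) \<subseteq> x \<and> x \<subseteq> U \<and> x \<inter> y = {0}}))"
  proof -
    have "?P = (SIGMA v:U - ?zy. {x \<in> S k. span (insert v z) \<subseteq> x \<and> x \<subseteq> U \<and> x \<inter> y = {0}})"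
      (is "_ = ?R")
    proof (intro equalityI subsetI)
      fix vx assume "vx \<in> ?P"
      then obtain v x where vx: "vx = (v, x)" and x: "x \<in> ?X" and v: "v \<in> x" "v \<notin> z" by auto
      have sx: "subspace x" using x S_iff by blast
      have "v \<notin> ?zy"
      proof
        assume "v \<in> ?zy"
        then obtain a b where ab: "v = a + b" "a \<in> z" "b \<in> y" by blast
        then have "b = v - a" by simp
        then have "b \<in> x" using v ab x sx subspace_diff by blast
        then have "b = 0" using ab x by blast
        then show False using ab v by simp
      qed
      moreover have "span (insert v z) \<subseteq> x" using v x sx by (intro span_minimal) auto
      ultimately show "vx \<in> ?R" using vx x v by auto
    next
      fix vx assume "vx \<in> ?R"
      then obtain v x where vx: "vx = (v, x)" and v: "v \<in> U" "v \<notin> ?zy"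
        and x: "x \<in> S k" "span (insert v z) \<subseteq> x" "x \<subseteq> U" "x \<inter> y = {0}" by blast
      have "insert v z \<subseteq> x" using x(2) span_superset by blast
      then show "vx \<in> ?P" using vx v x zzy by auto
    qed
    then show ?thesis by simp
  qed
  also have "\<dots> = (\<Sum>v\<in>U - ?zy. qcount q m l (Suc j) k)"
  proof (rule sum.cong[OF refl])
    fix v assume v: "v \<in> U - ?zy"
    let ?z = "span (insert v z)"
    have "v \<notin> z" using v zzy by auto
    then have "?z \<in> S (Suc j)" using span_insert_subspace[of z v] sz by simp
    moreover have "?z \<subseteq> U" using v sz step.prems by (intro span_minimal) auto
    moreover have "?z \<inter> y = {0}"
    proof -
      have "w = 0" if w: "w \<in> ?z" "w \<in> y" for w
      proof -
        obtain c where c: "w - scale c v \<in> z"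
          using w(1) sz span_breakdown_eq span_eq_iff by metis
        have "c = 0"
        proof (rule ccontr)
          assume c0: "c \<noteq> 0"
          have "scale c v = - (w - scale c v) + w" by simp
          moreover have "- (w - scale c v) \<in> z" using c sz(1) by (rule subspace_neg[rotated])
          ultimately have "scale c v \<in> ?zy" using w by blast
          then have "scale (inverse c) (scale c v) \<in> ?zy" using szy subspace_scale by blast
          then show False using c0 v by simp
        qed
        then show ?thesis using c w step.prems by auto
      qed
      then show ?thesis using sz subspace_0 subspace_span by blast
    qed
    ultimately show "real (card {x \<in> S k. ?z \<subseteq> x \<and> x \<subseteq> U \<and> x \<inter> y = {0}}) = qcount q m l (Suc j) k"
      by (rule step.IH)
  qed
  also have "\<dots> = (real q ^ m - real q ^ (j + l)) * qcount q m l (Suc j) k"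
  proof -
    have "card (U - ?zy) = q ^ m - q ^ (j + l)" using czy cU zyU by (simp add: card_Diff_subset)
    moreover have "q ^ (j + l) \<le> q ^ m" using czy cU zyU card_mono[of U ?zy] by simp
    ultimately show ?thesis by (simp add: of_nat_diff)
  qed
  finally have "real (card ?X) * (real q ^ k - real q ^ j) = (real q ^ m - real q ^ (j + l)) * qcount q m l (Suc j) k"
    using 1 by simp
  moreover have "real q ^ j < real q ^ k" using step.hyps q_gt_1 by (simp add: power_strict_increasing)
  moreover have "qcount q m l j k = (real q ^ m - real q ^ (j + l)) / (real q ^ k - real q ^ j) * qcount q m l (Suc j) k"
    using step.hyps by (simp add: qcount_def prod.atLeast_Suc_lessThan)
  ultimately have "real (card ?X) * (real q ^ k - real q ^ j) = qcount q m l j k * (real q ^ k - real q ^ j)"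
    by simp
  then show ?case using \<open>real q ^ j < real q ^ k\<close> by simp
qed

end

subsection \<open>Moebius inversion and averaging over disjoint subspaces\<close>

text \<open>This is \<open>(-1)^m * q^(m choose 2)\<close>, the Moebius function of the subspace
  lattice of an \<open>m\<close>-space between its bottom and its top. The product form suits
  factorwise cancellation.\<close>

definition mob :: "nat \<Rightarrow> nat \<Rightarrow> real" where
  "mob q m = (\<Prod>i<m. - (real q ^ i))"

lemma qcount_split:
  assumes "j \<le> k"
  shows "qcount q m l 0 k = (\<Prod>i<j. (real q ^ m - real q ^ (i + l)) / (real q ^ k - real q ^ i)) * qcount q m l j k"
proof -
  have "{0..<k} = {..<j} \<union> {j..<k}" using assms by auto
  then show ?thesis 
    unfolding qcount_def by (simp only:, intro prod.union_disjoint) auto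
qed

lemma prod_power_diff:
  "(\<Prod>i<m. real q ^ m - real q ^ i) = (\<Prod>i<m. real q ^ i * (real q ^ Suc i - 1))"
proof -
  have "(\<Prod>i<m. real q ^ m - real q ^ i) = (\<Prod>i<m. real q ^ i * (real q ^ (m - i) - 1))"
    by (rule prod.cong) (auto simp: algebra_simps simp flip: power_add)
  also have "\<dots> = (\<Prod>i<m. real q ^ i) * (\<Prod>i<m. real q ^ (m - i) - 1)"
    by (simp add: prod.distrib)
  also have "(\<Prod>i<m. real q ^ (m - i) - 1) = (\<Prod>i<m. real q ^ (Suc i) - 1)"
    using prod.nat_diff_reindex[of "\<lambda>i. real q ^ (Suc i) - 1" m]
    by (simp add: Suc_diff_Suc cong: prod.cong_simp)
  finally show ?thesis by (simp add: prod.distrib)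
qed

text \<open>The powers of \<open>q\<close> in \<open>mob\<close> cancel against those in the product
  of the denominators of \<open>qcount\<close>. The factors that remain do not depend on
  \<open>m\<close>, which is what allows telescoping.\<close>

lemma mob_qcount:
  assumes "1 < q"
  shows "mob q m * qcount q d 0 0 m = (\<Prod>i<m. (real q ^ i - real q ^ d) / (real q ^ Suc i - 1))"
proof -
  have ne: "real q ^ m - real q ^ i \<noteq> 0" if "i < m" for i
    using that assms by simp
  have q0: "real q ^ i \<noteq> 0" for i using assms by simp
  have q1: "real q ^ Suc i - 1 \<noteq> 0" for i
    using assms one_less_power[of "real q" "Suc i"] by simp
  have "mob q m * qcount q d 0 0 m * (\<Prod>i<m. real q ^ m - real q ^ i)
      = mob q m * (\<Prod>i<m. real q ^ d - real q ^ i)"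
    using ne by (simp add: qcount_def prod_dividef atLeast0LessThan)
  also have "\<dots> = (\<Prod>i<m. (real q ^ i - real q ^ d) / (real q ^ Suc i - 1) * (real q ^ i * (real q ^ Suc i - 1)))"
    unfolding mob_def prod.distrib[symmetric]
    by (rule prod.cong) (use q1 in \<open>auto simp: field_simps\<close>)
  also have "\<dots> = (\<Prod>i<m. (real q ^ i - real q ^ d) / (real q ^ Suc i - 1)) * (\<Prod>i<m. real q ^ m - real q ^ i)"
    unfolding prod_power_diff by (simp only: prod.distrib)
  finally show ?thesis using ne by simp
qed

text \<open>The partial sums of the left-hand side telescope to a product that vanishes for
  \<open>M = d > 0\<close>.\<close>

lemma mob_qcount_sum:
  assumes "1 < q"
  shows "(\<Sum>m\<le>d. mob q m * qcount q d 0 0 m) = (if d = 0 then 1 else 0)"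
proof -
  have "(\<Sum>m\<le>M. mob q m * qcount q d 0 0 m) = (\<Prod>i<M. (real q ^ Suc i - real q ^ d) / (real q ^ Suc i - 1))" for M
  proof (induction M)
    case 0
    then show ?case by (simp add: mob_def qcount_def)
  next
    case (Suc M)
    have q1: "real q ^ Suc i - 1 \<noteq> 0" for i
      using assms one_less_power[of "real q" "Suc i"] by simp
    \<comment> \<open>The numerator factor with \<open>i = 0\<close> is split off; the shifted rest
      is the numerator in the induction hypothesis.\<close>
    have "mob q (Suc M) * qcount q d 0 0 (Suc M)
      = (1 - real q ^ d) * (\<Prod>i<M. real q ^ Suc i - real q ^ d) / ((\<Prod>i<M. real q ^ Suc i - 1) * (real q ^ Suc M - 1))"
      unfolding mob_qcount[OF assms] prod_dividef prod.lessThan_Suc_shift[of _ M]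
      by (subst prod.lessThan_Suc_shift[symmetric, where g = "\<lambda>i. real q ^ Suc i - 1"]) simp
    moreover have "(\<Prod>i<M. real q ^ Suc i - 1) \<noteq> 0" using q1 by simp
    ultimately show ?case using Suc.IH q1[of M] unfolding sum.atMost_Suc prod.lessThan_Suc prod_dividef
      by (simp add: field_simps)
  qed
  from this[of d] show ?thesis by (cases d) auto
qed

section \<open>Lifts, harmonic functions and the averages over disjoint subspaces\<close>

context finite_field_space
begin

definition lift :: "nat \<Rightarrow> ('v set \<Rightarrow> real) \<Rightarrow> 'v set \<Rightarrow> real" where
  "lift j \<phi> x = (\<Sum>z | z \<in> S j \<and> z \<subseteq> x. \<phi> z)"

text \<open>Orthogonality to the indicators of all stars of smaller spaces. Imposing it for every
  smaller dimension makes the lower terms of a Moebius sum vanish at once.\<close>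

definition harmonic :: "nat \<Rightarrow> ('v set \<Rightarrow> real) \<Rightarrow> bool" where
  "harmonic j \<phi> \<longleftrightarrow> (\<forall>i<j. \<forall>w\<in>S i. (\<Sum>z | z \<in> S j \<and> w \<subseteq> z. \<phi> z) = 0)"

text \<open>For \<open>y\<close> in \<open>S l\<close> the divisor is the number of summands, by
  \<open>card_S_disjoint\<close>.\<close>

definition T :: "nat \<Rightarrow> nat \<Rightarrow> ('v set \<Rightarrow> real) \<Rightarrow> 'v set \<Rightarrow> real" where
  "T k l f y = (\<Sum>x | x \<in> S k \<and> x \<inter> y = {0}. f x) / qcount q n l 0 k"

text \<open>The multiplier in \<open>T_lift\<close>: \<open>mob q j\<close> times
  \<open>qcount q n l j k / qcount q n l 0 k\<close>, with the common factors cancelled.\<close>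

definition ev :: "nat \<Rightarrow> nat \<Rightarrow> nat \<Rightarrow> real" where
  "ev j k l = (\<Prod>i<j. - (real q ^ i * (real q ^ k - real q ^ i) / (real q ^ n - real q ^ (i + l))))"

lemma qpow_less: "i < j \<Longrightarrow> real q ^ i < real q ^ j"
  using q_gt_1 by simp

lemma qcount_pos_ambient: "k + l \<le> m \<Longrightarrow> 0 < qcount q m l j k"
  unfolding qcount_def by (rule prod_pos) (auto intro!: divide_pos_pos qpow_less simp del: power_strict_increasing_iff)

lemma qcount_pos: "k + l \<le> n \<Longrightarrow> 0 < qcount q n l j k"
  by (rule qcount_pos_ambient)

text \<open>Grouping the subspaces of \<open>u\<close> by dimension reduces this to
  \<open>mob_qcount_sum\<close>.\<close>

lemma sum_mob:
  assumes "subspace u"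
  shows "(\<Sum>w | subspace w \<and> w \<subseteq> u. mob q (dim w)) = (if u = {0} then 1 else 0)"
proof -
  have "{w. subspace w \<and> w \<subseteq> u} = (\<Union>m\<in>{..dim u}. {w \<in> S m. w \<subseteq> u})"
    by (auto simp: S_iff intro: dim_subset)
  then have "(\<Sum>w | subspace w \<and> w \<subseteq> u. mob q (dim w)) = (\<Sum>m\<le>dim u. \<Sum>w | w \<in> S m \<and> w \<subseteq> u. mob q (dim w))"
    by (simp only:, intro sum.UNION_disjoint) (simp_all, auto simp: S_iff)
  also have "\<dots> = (\<Sum>m\<le>dim u. mob q m * qcount q (dim u) 0 0 m)"
  proof (rule sum.cong[OF refl])
    fix m
    have "real (card {w \<in> S m. {0} \<subseteq> w \<and> w \<subseteq> u \<and> w \<inter> {0} = {0}}) = qcount q (dim u) 0 0 m"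
      by (rule card_between_disjoint[of u _ "{0}" 0 "{0}" 0])
        (use assms in \<open>simp_all add: S_0 subspace_0, simp add: S_iff\<close>)
    moreover have "{w \<in> S m. {0} \<subseteq> w \<and> w \<subseteq> u \<and> w \<inter> {0} = {0}} = {w \<in> S m. w \<subseteq> u}"
      by (auto simp: S_iff subspace_0)
    ultimately show "(\<Sum>w | w \<in> S m \<and> w \<subseteq> u. mob q (dim w)) = mob q m * qcount q (dim u) 0 0 m"
      by (simp add: S_iff)
  qed
  also have "\<dots> = (if dim u = 0 then 1 else 0)" by (rule mob_qcount_sum[OF q_gt_1])
  also have "dim u = 0 \<longleftrightarrow> u = {0}" using assms S_0 S_iff[of u 0] by simp
  finally show ?thesis .
qed

text \<open>Moebius inversion replaces the condition \<open>z \<inter> y = {0}\<close> by a sum over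
  subspaces \<open>w\<close> of \<open>z \<inter> y\<close>. After the sums are exchanged,
  \<open>w\<close> of dimension below \<open>j\<close> contributes zero by harmonicity,
  \<open>w\<close> of dimension above \<open>j\<close> lies in no \<open>z\<close>, and dimension
  \<open>j\<close> leaves \<open>z = w\<close>.\<close>

lemma harmonic_sum_disjoint:
  assumes "harmonic j \<phi>" "subspace y"
  shows "(\<Sum>z | z \<in> S j \<and> z \<inter> y = {0}. \<phi> z) = mob q j * lift j \<phi> y"
proof -
  have "(\<Sum>z | z \<in> S j \<and> z \<inter> y = {0}. \<phi> z) = (\<Sum>z\<in>S j. \<phi> z * (if z \<inter> y = {0} then 1 else 0))"
    by (simp add: sum.If_cases Int_def if_distrib cong: if_cong)
  also have "\<dots> = (\<Sum>z\<in>S j. \<Sum>w | w \<in> {w. subspace w \<and> w \<subseteq> y} \<and> w \<subseteq> z. \<phi> z * mob q (dim w))"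
  proof (rule sum.cong[OF refl])
    fix z assume "z \<in> S j"
    then have "subspace (z \<inter> y)" using assms S_iff subspace_inter by blast
    from sum_mob[OF this] have "(if z \<inter> y = {0} then 1 else 0) = (\<Sum>w | w \<in> {w. subspace w \<and> w \<subseteq> y} \<and> w \<subseteq> z. mob q (dim w))"
      by (simp add: conj_ac)
    then show "\<phi> z * (if z \<inter> y = {0} then 1 else 0) = (\<Sum>w | w \<in> {w. subspace w \<and> w \<subseteq> y} \<and> w \<subseteq> z. \<phi> z * mob q (dim w))"
      by (simp add: sum_distrib_left)
  qed
  also have "\<dots> = (\<Sum>w | subspace w \<and> w \<subseteq> y. \<Sum>z | z \<in> S j \<and> w \<subseteq> z. \<phi> z * mob q (dim w))"
    by (subst sum.swap_restrict) auto
  also have "\<dots> = (\<Sum>w | subspace w \<and> w \<subseteq> y. if dim w = j then mob q j * \<phi> w else 0)"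
  proof (rule sum.cong[OF refl])
    fix w assume w: "w \<in> {w. subspace w \<and> w \<subseteq> y}"
    consider "dim w < j" | "dim w = j" | "dim w > j" by linarith
    then show "(\<Sum>z | z \<in> S j \<and> w \<subseteq> z. \<phi> z * mob q (dim w)) = (if dim w = j then mob q j * \<phi> w else 0)"
    proof cases
      case 1
      then show ?thesis using assms w by (auto simp: harmonic_def S_iff simp flip: sum_distrib_right)
    next
      case 2
      have "z = w" if "z \<in> S j" "w \<subseteq> z" for z
        using that 2 w subspace_dim_equal[of w z] by (simp add: S_iff)
      then have "{z. z \<in> S j \<and> w \<subseteq> z} = {w}" using w 2 by (auto simp: S_iff)
      then show ?thesis using 2 by simp
    next
      case 3
      have "\<not> w \<subseteq> z" if "z \<in> S j" for z using that 3 dim_subset[of w z] by (auto simp: S_iff)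
      then have "{z. z \<in> S j \<and> w \<subseteq> z} = {}" by blast
      then show ?thesis using 3 by (simp only: sum.empty) simp
    qed
  qed
  also have "\<dots> = mob q j * lift j \<phi> y"
    unfolding lift_def sum_distrib_left
    by (rule sum.mono_neutral_cong_right) (auto simp: S_iff)
  finally show ?thesis .
qed

lemma UNIV_S: "UNIV \<in> S n"
  unfolding S_iff using dim_UNIV_n subspace_UNIV by blast

lemma card_disjoint_above:
  assumes "z \<in> S j" "y \<in> S l" "j \<le> k"
  shows "real (card {x \<in> S k. z \<subseteq> x \<and> x \<inter> y = {0}}) = (if z \<inter> y = {0} then qcount q n l j k else 0)"
proof (cases "z \<inter> y = {0}")
  case True
  have "real (card {x \<in> S k. z \<subseteq> x \<and> x \<subseteq> UNIV \<and> x \<inter> y = {0}}) = qcount q n l j k"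
    by (rule card_between_disjoint) (use assms True in \<open>auto simp: UNIV_S\<close>)
  then show ?thesis using True by simp
next
  case False
  have "0 \<in> z \<inter> y" using assms by (auto simp: S_iff subspace_0)
  then have "{x \<in> S k. z \<subseteq> x \<and> x \<inter> y = {0}} = {}" using False by auto
  then show ?thesis using False by simp
qed

text \<open>The number of \<open>k\<close>-spaces that contain \<open>z\<close> and miss
  \<open>y\<close> depends only on whether \<open>z\<close> misses \<open>y\<close>, so exchanging
  the sums leaves the sum in \<open>harmonic_sum_disjoint\<close>.\<close>

lemma T_lift:
  assumes "harmonic j \<phi>" "j \<le> k" "k + l \<le> n" "y \<in> S l"
  shows "T k l (lift j \<phi>) y = ev j k l * lift j \<phi> y"
proof -
  have "(\<Sum>x | x \<in> S k \<and> x \<inter> y = {0}. lift j \<phi> x)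
     = (\<Sum>z\<in>S j. \<Sum>x | x \<in> {x. x \<in> S k \<and> x \<inter> y = {0}} \<and> z \<subseteq> x. \<phi> z)"
    unfolding lift_def by (subst sum.swap_restrict) auto
  also have "\<dots> = (\<Sum>z\<in>S j. real (card {x \<in> S k. z \<subseteq> x \<and> x \<inter> y = {0}}) * \<phi> z)"
    by (simp add: conj_ac)
  also have "\<dots> = (\<Sum>z\<in>S j. if z \<inter> y = {0} then qcount q n l j k * \<phi> z else 0)"
    using card_disjoint_above[OF _ assms(4,2)] by (intro sum.cong) auto
  also have "\<dots> = qcount q n l j k * (\<Sum>z | z \<in> S j \<and> z \<inter> y = {0}. \<phi> z)"
    by (simp add: sum.If_cases Int_def sum_distrib_left)
  also have "\<dots> = qcount q n l j k * (mob q j * lift j \<phi> y)"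
    using assms harmonic_sum_disjoint S_iff by simp
  finally have 1: "T k l (lift j \<phi>) y = (qcount q n l j k * mob q j / qcount q n l 0 k) * lift j \<phi> y"
    unfolding T_def by simp
  have "qcount q n l j k \<noteq> 0" using qcount_pos[of k l j] assms by simp
  then have "qcount q n l j k * mob q j / qcount q n l 0 k
     = mob q j / (\<Prod>i<j. (real q ^ n - real q ^ (i + l)) / (real q ^ k - real q ^ i))"
    by (simp add: qcount_split[OF \<open>j \<le> k\<close>])
  also have "\<dots> = ev j k l"
    unfolding mob_def ev_def prod_dividef[symmetric] by (rule prod.cong) auto
  finally show ?thesis using 1 by simp
qed

section \<open>Disjoint pairs and the adjoint of the averaging operator\<close>

lemma card_S_disjoint: "y \<in> S l \<Longrightarrow> real (card {x \<in> S k. x \<inter> y = {0}}) = qcount q n l 0 k"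
proof -
  assume y: "y \<in> S l"
  have "{x \<in> S k. {0} \<subseteq> x \<and> x \<inter> y = {0}} = {x \<in> S k. x \<inter> y = {0}}"
    by (auto simp: S_iff subspace_0)
  then show ?thesis using card_disjoint_above[of "{0}" 0 y l k] y S_0 by (auto simp: S_iff subspace_0)
qed

lemma card_S_eq: "real (card (S k)) = qcount q n 0 0 k"
proof -
  have "{x \<in> S k. x \<inter> {0} = {0}} = S k" by (auto simp: S_iff subspace_0)
  then show ?thesis using card_S_disjoint[of "{0}" 0 k] S_0 by simp
qed

text \<open>Normalised to an expectation, so that \<open>T k l\<close> and \<open>T l k\<close>
  become adjoint although they relate spaces of functions on different sets.\<close>

definition ip :: "nat \<Rightarrow> ('v set \<Rightarrow> real) \<Rightarrow> ('v set \<Rightarrow> real) \<Rightarrow> real" where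
  "ip k f g = (\<Sum>x\<in>S k. f x * g x) / real (card (S k))"

text \<open>Both sides count the disjoint pairs of a \<open>k\<close>-space and an
  \<open>l\<close>-space.\<close>

lemma qcount_swap:
  "real (card (S l)) * qcount q n l 0 k = real (card (S k)) * qcount q n k 0 l"
proof -
  have "(\<Sum>y\<in>S l. \<Sum>x | x \<in> S k \<and> x \<inter> y = {0}. 1) = (\<Sum>x\<in>S k. \<Sum>y | y \<in> S l \<and> x \<inter> y = {0}. 1 :: real)"
    by (rule sum.swap_restrict) auto
  moreover have "(\<Sum>y\<in>S l. \<Sum>x | x \<in> S k \<and> x \<inter> y = {0}. 1 :: real) = (\<Sum>y\<in>S l. qcount q n l 0 k)"
    by (rule sum.cong) (simp_all add: card_S_disjoint)
  moreover have "(\<Sum>x\<in>S k. \<Sum>y | y \<in> S l \<and> x \<inter> y = {0}. 1 :: real) = (\<Sum>x\<in>S k. qcount q n k 0 l)"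
  proof (rule sum.cong[OF refl])
    fix x assume "x \<in> S k"
    then have "real (card {y \<in> S l. y \<inter> x = {0}}) = qcount q n k 0 l" by (rule card_S_disjoint)
    moreover have "{y \<in> S l. x \<inter> y = {0}} = {y \<in> S l. y \<inter> x = {0}}" by blast
    ultimately show "(\<Sum>y | y \<in> S l \<and> x \<inter> y = {0}. 1 :: real) = qcount q n k 0 l" by simp
  qed
  ultimately show ?thesis by simp
qed

text \<open>Both sides are the sum of \<open>f x * g y\<close> over disjoint pairs;
  \<open>qcount_swap\<close> shows that the normalisations agree.\<close>

lemma ip_T:
  assumes "k + l \<le> n"
  shows "ip l (T k l f) g = ip k f (T l k g)"
proof -
  have "(\<Sum>y\<in>S l. \<Sum>x | x \<in> S k \<and> x \<inter> y = {0}. f x * g y) = (\<Sum>x\<in>S k. \<Sum>y | y \<in> S l \<and> x \<inter> y = {0}. f x * g y)"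
    by (rule sum.swap_restrict) auto
  moreover have "(\<Sum>y\<in>S l. \<Sum>x | x \<in> S k \<and> x \<inter> y = {0}. f x * g y)
    = ip l (T k l f) g * (real (card (S l)) * qcount q n l 0 k)"
  proof -
    have "(\<Sum>y\<in>S l. \<Sum>x | x \<in> S k \<and> x \<inter> y = {0}. f x * g y) = (\<Sum>y\<in>S l. (T k l f y * g y) * qcount q n l 0 k)"
      using qcount_pos[of k l 0] assms by (simp add: T_def flip: sum_distrib_right)
    then show ?thesis
      using qcount_pos[of l 0 0] assms by (simp add: ip_def card_S_eq flip: sum_distrib_right)
  qed
  moreover have "(\<Sum>x\<in>S k. \<Sum>y | y \<in> S l \<and> x \<inter> y = {0}. f x * g y)
    = ip k f (T l k g) * (real (card (S k)) * qcount q n k 0 l)"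
  proof -
    have "(\<Sum>y | y \<in> S l \<and> x \<inter> y = {0}. f x * g y) = (f x * T l k g x) * qcount q n k 0 l" for x
    proof -
      have "{y. y \<in> S l \<and> x \<inter> y = {0}} = {y. y \<in> S l \<and> y \<inter> x = {0}}" by blast
      then show ?thesis using qcount_pos[of l k 0] assms by (simp add: T_def flip: sum_distrib_left)
    qed
    then show ?thesis
      using qcount_pos[of k 0 0] assms by (simp add: ip_def card_S_eq flip: sum_distrib_right)
  qed
  ultimately have "ip l (T k l f) g * (real (card (S l)) * qcount q n l 0 k) = ip k f (T l k g) * (real (card (S k)) * qcount q n k 0 l)"
    by simp
  then show ?thesis unfolding qcount_swap using qcount_pos[of l k 0] qcount_pos[of k 0 0] assms
    by (simp add: card_S_eq)
qed

end

subsection \<open>Harmonic decomposition\<close>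

text \<open>One step of Gram-Schmidt per index: project \<open>f\<close> and the new vector onto the
  old ones, then remove from the residual \<open>h\<close> of \<open>f\<close> its component along
  the residual \<open>r\<close> of the new vector.\<close>

lemma orthogonal_projection_exists:
  fixes v :: "'i \<Rightarrow> 'a \<Rightarrow> real"
  assumes "finite I" "finite X"
  shows "\<exists>c. \<forall>i\<in>I. (\<Sum>x\<in>X. (f x - (\<Sum>j\<in>I. c j * v j x)) * v i x) = 0"
  using assms(1)
proof (induction I arbitrary: f rule: finite_induct)
  case empty
  then show ?case by simp
next
  case (insert i I)
  obtain c1 where c1: "\<And>j. j \<in> I \<Longrightarrow> (\<Sum>x\<in>X. (f x - (\<Sum>j\<in>I. c1 j * v j x)) * v j x) = 0"
    using insert.IH[of f] by blast
  obtain c2 where c2: "\<And>j. j \<in> I \<Longrightarrow> (\<Sum>x\<in>X. (v i x - (\<Sum>j\<in>I. c2 j * v j x)) * v j x) = 0"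
    using insert.IH[of "v i"] by blast
  define h where "h = (\<lambda>x. f x - (\<Sum>j\<in>I. c1 j * v j x))"
  define r where "r = (\<lambda>x. v i x - (\<Sum>j\<in>I. c2 j * v j x))"
  \<comment> \<open>If \<open>r\<close> vanishes on \<open>X\<close>, then \<open>t\<close> is zero
    by the convention for division, and the numerator is zero as well.\<close>
  define t where "t = (\<Sum>x\<in>X. h x * r x) / (\<Sum>x\<in>X. r x * r x)"
  define c where "c = (\<lambda>j. if j = i then t else c1 j - t * c2 j)"
  have hr: "f x - (\<Sum>j\<in>insert i I. c j * v j x) = h x - t * r x" for x
  proof -
    have "(\<Sum>j\<in>I. c j * v j x) = (\<Sum>j\<in>I. (c1 j - t * c2 j) * v j x)"
      using insert.hyps by (intro sum.cong) (auto simp: c_def)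
    also have "\<dots> = (\<Sum>j\<in>I. c1 j * v j x) - t * (\<Sum>j\<in>I. c2 j * v j x)"
      by (simp add: left_diff_distrib sum_subtractf sum_distrib_left mult.assoc)
    finally show ?thesis using insert.hyps by (simp add: h_def r_def c_def algebra_simps)
  qed
  have orth: "(\<Sum>x\<in>X. (h x - t * r x) * v j x) = 0" if "j \<in> I" for j
  proof -
    have "(\<Sum>x\<in>X. (h x - t * r x) * v j x) = (\<Sum>x\<in>X. h x * v j x) - t * (\<Sum>x\<in>X. r x * v j x)"
      by (simp add: left_diff_distrib sum_subtractf sum_distrib_left mult.assoc)
    then show ?thesis using c1[OF that] c2[OF that] by (simp add: h_def r_def)
  qed
  have "(\<Sum>x\<in>X. h x * r x) = t * (\<Sum>x\<in>X. r x * r x)"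
  proof (cases "(\<Sum>x\<in>X. r x * r x) = 0")
    case True
    then have "\<forall>x\<in>X. r x = 0" using assms(2) by (subst (asm) sum_nonneg_eq_0_iff) auto
    then show ?thesis by simp
  qed (simp add: t_def)
  then have "(\<Sum>x\<in>X. (h x - t * r x) * r x) = 0"
    by (simp add: left_diff_distrib sum_subtractf sum_distrib_left mult.assoc)
  moreover have "(\<Sum>x\<in>X. (h x - t * r x) * v i x)
      = (\<Sum>x\<in>X. (h x - t * r x) * r x) + (\<Sum>j\<in>I. c2 j * (\<Sum>x\<in>X. (h x - t * r x) * v j x))"
  proof -
    have "(\<Sum>j\<in>I. c2 j * (\<Sum>x\<in>X. (h x - t * r x) * v j x)) = (\<Sum>x\<in>X. (h x - t * r x) * (\<Sum>j\<in>I. c2 j * v j x))"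
      unfolding sum_distrib_left by (subst sum.swap) (simp add: mult_ac)
    moreover have "v i x = r x + (\<Sum>j\<in>I. c2 j * v j x)" for x by (simp add: r_def)
    ultimately show ?thesis by (simp add: distrib_left sum.distrib)
  qed
  ultimately have "(\<Sum>x\<in>X. (h x - t * r x) * v i x) = 0" using orth by simp
  then show ?case using orth unfolding hr[symmetric] by (intro exI[of _ c]) auto
qed

context finite_field_space
begin

lemma lift_self: "x \<in> S k \<Longrightarrow> lift k \<phi> x = \<phi> x"
proof -
  assume x: "x \<in> S k"
  have "z = x" if "z \<in> S k" "z \<subseteq> x" for z
    using that x subspace_dim_equal[of z x] by (simp add: S_iff)
  then have "{z. z \<in> S k \<and> z \<subseteq> x} = {x}" using x by blast
  then show ?thesis by (simp add: lift_def)
qed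

lemma lift_above: "x \<in> S k \<Longrightarrow> k < j \<Longrightarrow> lift j \<phi> x = 0"
proof -
  assume x: "x \<in> S k" "k < j"
  have "\<not> z \<subseteq> x" if "z \<in> S j" for z using that x dim_subset[of z x] by (auto simp: S_iff)
  then have "{z. z \<in> S j \<and> z \<subseteq> x} = {}" by blast
  then show ?thesis unfolding lift_def by (simp only: sum.empty)
qed

lemma lift_0: "subspace x \<Longrightarrow> lift 0 \<phi> x = \<phi> {0}"
proof -
  assume "subspace x"
  then have "{z. z \<in> S 0 \<and> z \<subseteq> x} = {{0}}" using S_0 subspace_0 by auto
  then show ?thesis by (simp add: lift_def)
qed

lemma lift_cong: "(\<And>z. z \<in> S j \<Longrightarrow> \<phi> z = \<psi> z) \<Longrightarrow> lift j \<phi> x = lift j \<psi> x"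
  unfolding lift_def by (rule sum.cong) auto

lemma lift_sum: "lift j (\<lambda>z. \<Sum>i\<in>A. \<phi> i z) x = (\<Sum>i\<in>A. lift j (\<phi> i) x)"
  unfolding lift_def by (rule sum.swap)

lemma lift_scale: "lift j (\<lambda>z. c * \<phi> z) x = c * lift j \<phi> x"
  by (simp add: lift_def sum_distrib_left)

text \<open>Each \<open>j\<close>-space in \<open>x\<close> is counted once for every
  \<open>i\<close>-space between it and \<open>x\<close>.\<close>

lemma lift_lift:
  assumes "x \<in> S k" "j \<le> i"
  shows "lift i (lift j \<phi>) x = qcount q k 0 j i * lift j \<phi> x"
proof -
  have "lift i (lift j \<phi>) x = (\<Sum>z\<in>S j. \<Sum>w | w \<in> {w. w \<in> S i \<and> w \<subseteq> x} \<and> z \<subseteq> w. \<phi> z)"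
    unfolding lift_def by (subst sum.swap_restrict) auto
  also have "\<dots> = (\<Sum>z\<in>S j. real (card {w \<in> S i. z \<subseteq> w \<and> w \<subseteq> x}) * \<phi> z)"
    by (simp add: conj_ac)
  also have "\<dots> = (\<Sum>z\<in>S j. if z \<subseteq> x then qcount q k 0 j i * \<phi> z else 0)"
  proof (rule sum.cong[OF refl])
    fix z assume z: "z \<in> S j"
    show "real (card {w \<in> S i. z \<subseteq> w \<and> w \<subseteq> x}) * \<phi> z = (if z \<subseteq> x then qcount q k 0 j i * \<phi> z else 0)"
    proof (cases "z \<subseteq> x")
      case True
      have "{w \<in> S i. z \<subseteq> w \<and> w \<subseteq> x} = {w \<in> S i. z \<subseteq> w \<and> w \<subseteq> x \<and> w \<inter> {0} = {0}}"
        by (auto simp: S_iff subspace_0)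
      moreover have "real (card {w \<in> S i. z \<subseteq> w \<and> w \<subseteq> x \<and> w \<inter> {0} = {0}}) = qcount q k 0 j i"
        by (rule card_between_disjoint) (use assms z True S_0 in \<open>auto simp: S_iff subspace_0\<close>)
      ultimately show ?thesis using True by simp
    next
      case False
      then have "{w \<in> S i. z \<subseteq> w \<and> w \<subseteq> x} = {}" by blast
      then show ?thesis using False by (simp only: card.empty) simp
    qed
  qed
  also have "\<dots> = qcount q k 0 j i * lift j \<phi> x"
    by (simp add: sum.If_cases Int_def sum_distrib_left lift_def)
  finally show ?thesis .
qed

lemma harmonic_comb:
  assumes "\<And>i. i \<in> A \<Longrightarrow> harmonic j (\<phi> i)"
  shows "harmonic j (\<lambda>z. \<Sum>i\<in>A. c i * \<phi> i z)"
  unfolding harmonic_def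
proof (intro allI impI ballI)
  fix i w assume "i < j" "w \<in> S i"
  then have "(\<Sum>z | z \<in> S j \<and> w \<subseteq> z. \<phi> a z) = 0" if "a \<in> A" for a
    using assms[OF that] by (simp add: harmonic_def)
  then show "(\<Sum>z | z \<in> S j \<and> w \<subseteq> z. \<Sum>i\<in>A. c i * \<phi> i z) = 0"
    by (subst sum.swap) (simp flip: sum_distrib_left)
qed

text \<open>Project \<open>f\<close> onto the span of the indicators of the stars of all spaces of
  dimension below \<open>k\<close>. The residual is harmonic of degree \<open>k\<close>. The
  projection is a sum of lifts of its coefficient functions on lower dimensions; these decompose by
  induction, and \<open>lift_lift\<close> merges the repeated lifts.\<close>

lemma harmonic_decomposition_aux:
  "\<exists>\<Phi>. (\<forall>j. harmonic j (\<Phi> j)) \<and> (\<forall>x\<in>S k. f x = (\<Sum>j\<le>k. lift j (\<Phi> j) x))"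
proof (induction k arbitrary: f rule: less_induct)
  case (less k)
  let ?I = "\<Union>i\<in>{..<k}. S i"
  let ?v = "\<lambda>w x. if w \<subseteq> x then 1 else 0 :: real"
  obtain c where c: "\<And>w. w \<in> ?I \<Longrightarrow> (\<Sum>x\<in>S k. (f x - (\<Sum>u\<in>?I. c u * ?v u x)) * ?v w x) = 0"
    using orthogonal_projection_exists[of ?I "S k" f ?v] by auto
  define h where "h = (\<lambda>x. f x - (\<Sum>u\<in>?I. c u * ?v u x))"
  have h: "harmonic k h"
    unfolding harmonic_def
  proof (intro allI impI ballI)
    fix i w assume "i < k" "w \<in> S i"
    then have "(\<Sum>x\<in>S k. h x * ?v w x) = 0" using c by (auto simp: h_def)
    then show "(\<Sum>z | z \<in> S k \<and> w \<subseteq> z. h z) = 0"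
      by (simp add: if_distrib sum.If_cases Int_def cong: if_cong)
  qed
  have "\<forall>i\<in>{..<k}. \<exists>\<Phi>. (\<forall>j. harmonic j (\<Phi> j)) \<and> (\<forall>x\<in>S i. c x = (\<Sum>j\<le>i. lift j (\<Phi> j) x))"
    using less.IH by blast
  then obtain \<Psi> where \<Psi>: "\<And>i j. i < k \<Longrightarrow> harmonic j (\<Psi> i j)"
    "\<And>i x. i < k \<Longrightarrow> x \<in> S i \<Longrightarrow> c x = (\<Sum>j\<le>i. lift j (\<Psi> i j) x)"
    by (auto dest!: bchoice)
  \<comment> \<open>Degree \<open>j\<close> collects the degree-\<open>j\<close> parts of the
    coefficients from every dimension \<open>i < k\<close>, with the factors of
    \<open>lift_lift\<close>.\<close>
  define \<Phi> where "\<Phi> = (\<lambda>j. if j = k then h else (\<lambda>z. \<Sum>i\<in>{j..<k}. qcount q k 0 j i * \<Psi> i j z))"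
  have "harmonic j (\<Phi> j)" for j
    using h \<Psi>(1) by (auto simp: \<Phi>_def intro!: harmonic_comb)
  moreover have "f x = (\<Sum>j\<le>k. lift j (\<Phi> j) x)" if x: "x \<in> S k" for x
  proof -
    have "(\<Sum>u\<in>?I. c u * ?v u x) = (\<Sum>i<k. \<Sum>u\<in>S i. c u * ?v u x)"
      by (rule sum.UNION_disjoint) (simp_all, auto simp: S_iff)
    also have "\<dots> = (\<Sum>i<k. lift i c x)"
      by (simp add: if_distrib sum.If_cases Int_def lift_def cong: if_cong)
    also have "\<dots> = (\<Sum>i<k. \<Sum>j\<le>i. qcount q k 0 j i * lift j (\<Psi> i j) x)"
    proof (rule sum.cong[OF refl])
      fix i assume i: "i \<in> {..<k}"
      have "lift i c x = lift i (\<lambda>x. \<Sum>j\<le>i. lift j (\<Psi> i j) x) x"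
        by (rule lift_cong) (use i \<Psi> in auto)
      also have "\<dots> = (\<Sum>j\<le>i. qcount q k 0 j i * lift j (\<Psi> i j) x)"
        unfolding lift_sum by (rule sum.cong) (use x lift_lift in auto)
      finally show "lift i c x = (\<Sum>j\<le>i. qcount q k 0 j i * lift j (\<Psi> i j) x)" .
    qed
    also have "\<dots> = (\<Sum>i<k. \<Sum>j | j \<in> {..<k} \<and> j \<le> i. qcount q k 0 j i * lift j (\<Psi> i j) x)"
      by (intro sum.cong) auto
    also have "\<dots> = (\<Sum>j<k. \<Sum>i | i \<in> {..<k} \<and> j \<le> i. qcount q k 0 j i * lift j (\<Psi> i j) x)"
      by (rule sum.swap_restrict) auto
    also have "\<dots> = (\<Sum>j<k. lift j (\<Phi> j) x)"
    proof (rule sum.cong[OF refl])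
      fix j assume j: "j \<in> {..<k}"
      have "{i. i \<in> {..<k} \<and> j \<le> i} = {j..<k}" by auto
      then show "(\<Sum>i | i \<in> {..<k} \<and> j \<le> i. qcount q k 0 j i * lift j (\<Psi> i j) x) = lift j (\<Phi> j) x"
        using j by (simp add: \<Phi>_def lift_sum lift_scale)
    qed
    finally have "f x = h x + (\<Sum>j<k. lift j (\<Phi> j) x)" by (simp add: h_def)
    moreover have "lift k (\<Phi> k) x = h x" using lift_self[OF x] by (simp add: \<Phi>_def)
    ultimately show ?thesis by (simp flip: lessThan_Suc_atMost)
  qed
  ultimately show ?case by blast
qed

text \<open>Lifts of degree above \<open>k\<close> vanish on \<open>k\<close>-spaces, so families of
  different dimensions can share one range of degrees.\<close>

lemma harmonic_decomposition:
  assumes "k \<le> m"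
  obtains \<Phi> where "\<And>j. harmonic j (\<Phi> j)" "\<And>x. x \<in> S k \<Longrightarrow> f x = (\<Sum>j\<le>m. lift j (\<Phi> j) x)"
proof -
  obtain \<Phi> where \<Phi>: "\<And>j. harmonic j (\<Phi> j)" "\<And>x. x \<in> S k \<Longrightarrow> f x = (\<Sum>j\<le>k. lift j (\<Phi> j) x)"
    using harmonic_decomposition_aux by blast
  moreover have "(\<Sum>j\<le>k. lift j (\<Phi> j) x) = (\<Sum>j\<le>m. lift j (\<Phi> j) x)" if "x \<in> S k" for x
    using assms that by (intro sum.mono_neutral_left) (auto simp: lift_above)
  ultimately show ?thesis by (intro that[of \<Phi>]) simp_all
qed

section \<open>The multipliers and their decay\<close>

definition lam :: "nat \<Rightarrow> nat \<Rightarrow> real" where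
  "lam k j = (\<Prod>i<j. real q ^ i * (real q ^ k - real q ^ i) / (real q ^ n - real q ^ (i + k)))"

lemma ev_lam: "ev j k k = (-1) ^ j * lam k j"
  by (induction j) (simp_all add: ev_def lam_def)

text \<open>The two products exchange their denominators and the signs cancel. Thus going from
  \<open>k\<close> to \<open>l\<close> and back has a multiplier that separates into a
  \<open>k\<close>-part and an \<open>l\<close>-part.\<close>

lemma ev_mult_ev: "ev j k l * ev j l k = lam k j * lam l j"
  unfolding ev_def lam_def prod.distrib[symmetric] by (rule prod.cong) simp_all

lemma lam_0: "lam k 0 = 1"
  by (simp add: lam_def)

lemma lam_above: "k < j \<Longrightarrow> lam k j = 0"
  unfolding lam_def by (rule prod_zero) auto

lemma lam_pos:
  assumes "2 * k \<le> n" "j \<le> k" shows "0 < lam k j"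
  unfolding lam_def
proof (rule prod_pos)
  fix i assume "i \<in> {..<j}"
  then show "0 < real q ^ i * (real q ^ k - real q ^ i) / (real q ^ n - real q ^ (i + k))"
    using assms q_gt_1 qpow_less[of i k] qpow_less[of "i + k" n] by auto
qed

lemma lam_nonneg: "2 * k \<le> n \<Longrightarrow> 0 \<le> lam k j"
  using lam_pos[of k j] lam_above[of k j] by (cases "j \<le> k") (auto intro: less_imp_le)

text \<open>For \<open>j < k\<close> the new factor is at most one half because
  \<open>2 * q^j \<le> q^k\<close> and \<open>q^(2 * k) \<le> q^n\<close>. From \<open>j = k\<close>
  on the left-hand side is zero.\<close>

lemma lam_Suc_le:
  assumes "2 * k \<le> n" shows "lam k (Suc j) \<le> lam k j / 2"
proof (cases "j < k")
  case True
  let ?Q = "real q"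
  have "2 * ?Q ^ j \<le> ?Q ^ Suc j" using q_gt_1 by simp
  also have "\<dots> \<le> ?Q ^ k" using True q_gt_1 by (intro power_increasing) auto
  finally have "2 * ?Q ^ j * (?Q ^ k - ?Q ^ j) \<le> ?Q ^ k * (?Q ^ k - ?Q ^ j)"
    using qpow_less[OF True] by (intro mult_right_mono) auto
  also have "\<dots> = ?Q ^ (2 * k) - ?Q ^ (j + k)"
    by (simp add: algebra_simps mult_2 mult_2_right power_add)
  also have "\<dots> \<le> ?Q ^ n - ?Q ^ (j + k)" using assms q_gt_1 by (simp add: power_increasing)
  finally have "?Q ^ j * (?Q ^ k - ?Q ^ j) / (?Q ^ n - ?Q ^ (j + k)) \<le> 1 / 2"
    using qpow_less[of "j + k" n] True assms by (simp add: field_simps)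
  from mult_left_mono[OF this lam_nonneg[OF assms, of j]] show ?thesis
    by (simp add: lam_def)
next
  case False
  then show ?thesis using lam_above[of k "Suc j"] lam_nonneg[OF assms, of j] by simp
qed

lemma lam_le_half:
  assumes "2 * k \<le> n" "2 \<le> j" shows "lam k j \<le> lam k 1 / 2"
  using assms(2)
proof (induction j rule: nat_induct_at_least)
  case base
  then show ?case using lam_Suc_le[of k 1] assms(1) by (simp add: numeral_2_eq_2)
next
  case (Suc j)
  then show ?case using lam_Suc_le[of k j] lam_nonneg[of k j] assms(1) by simp
qed

lemma lam_less:
  assumes "2 * k \<le> n" "i < j" "j \<le> k" shows "lam k j < lam k i"
  using assms(2,3)
proof (induction j)
  case (Suc j)
  have "lam k (Suc j) < lam k j"
    using lam_Suc_le[of k j] lam_pos[of k j] assms(1) Suc.prems by simp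
  then show ?case using Suc by (cases "i = j") auto
qed simp

section \<open>Inner products and the action of the averages degree by degree\<close>

lemma T_cong: "(\<And>x. x \<in> S k \<Longrightarrow> f x = g x) \<Longrightarrow> T k l f y = T k l g y"
  unfolding T_def by (intro arg_cong2[where f = "(/)"] sum.cong) auto

lemma T_sum: "T k l (\<lambda>x. \<Sum>i\<in>A. f i x) y = (\<Sum>i\<in>A. T k l (f i) y)"
  unfolding T_def sum_divide_distrib[symmetric] by (subst sum.swap) simp

lemma ip_cong:
  "(\<And>x. x \<in> S k \<Longrightarrow> f x = f' x) \<Longrightarrow> (\<And>x. x \<in> S k \<Longrightarrow> g x = g' x) \<Longrightarrow> ip k f g = ip k f' g'"
  unfolding ip_def by (intro arg_cong2[where f = "(/)"] sum.cong) auto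

lemma ip_sum_left: "ip k (\<lambda>x. \<Sum>i\<in>A. f i x) g = (\<Sum>i\<in>A. ip k (f i) g)"
  unfolding ip_def sum_divide_distrib[symmetric] sum_distrib_right by (subst sum.swap) simp

lemma ip_commute: "ip k f g = ip k g f"
  by (simp add: ip_def mult.commute)

lemma ip_sum_right: "ip k f (\<lambda>x. \<Sum>i\<in>A. g i x) = (\<Sum>i\<in>A. ip k f (g i))"
  unfolding ip_commute[of k f] by (rule ip_sum_left)

lemma ip_scale_left: "ip k (\<lambda>x. c * f x) g = c * ip k f g"
  by (simp add: ip_def sum_distrib_left mult.assoc)

lemma ip_self_nonneg: "0 \<le> ip k f f"
  unfolding ip_def by (intro divide_nonneg_nonneg sum_nonneg) auto

lemma ip_Cauchy_Schwarz: "\<bar>ip k f g\<bar> \<le> sqrt (ip k f f) * sqrt (ip k g g)"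
proof -
  have "\<bar>\<Sum>x\<in>S k. f x * g x\<bar> \<le> (\<Sum>x\<in>S k. \<bar>f x\<bar> * \<bar>g x\<bar>)"
    by (rule order_trans[OF sum_abs]) (simp add: abs_mult)
  also have "\<dots> \<le> L2_set f (S k) * L2_set g (S k)" by (rule L2_set_mult_ineq)
  finally have "\<bar>ip k f g\<bar> \<le> L2_set f (S k) * L2_set g (S k) / real (card (S k))"
    by (simp add: ip_def divide_right_mono)
  also have "\<dots> = sqrt (ip k f f) * sqrt (ip k g g)"
    by (simp add: ip_def L2_set_def real_sqrt_divide power2_eq_square)
  finally show ?thesis .
qed

text \<open>For \<open>j > k\<close> both sides vanish: the lift is zero on \<open>k\<close>-spaces,
  and \<open>ev j k l\<close> has a zero factor at \<open>i = k\<close>.\<close>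

lemma T_lift_ip:
  assumes "harmonic j \<phi>" "k + l \<le> n"
  shows "ip l (T k l (lift j \<phi>)) g = ev j k l * ip l (lift j \<phi>) g"
proof (cases "j \<le> k")
  case True
  then have "ip l (T k l (lift j \<phi>)) g = ip l (\<lambda>y. ev j k l * lift j \<phi> y) g"
    using assms by (intro ip_cong) (auto simp: T_lift)
  then show ?thesis by (simp add: ip_scale_left)
next
  case False
  have "ip l (T k l (lift j \<phi>)) g = ip k (lift j \<phi>) (T l k g)" by (rule ip_T[OF assms(2)])
  also have "\<dots> = ip k (\<lambda>_. 0) (T l k g)" using False by (intro ip_cong) (auto simp: lift_above)
  finally have 1: "ip l (T k l (lift j \<phi>)) g = 0" by (simp add: ip_def)
  have "ev j k l = 0" unfolding ev_def using False by (intro prod_zero) auto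
  then show ?thesis using 1 by simp
qed

text \<open>Lifts of different degrees are eigenfunctions of the self-adjoint operator \<open>T k k\<close> for
  different eigenvalues.\<close>

lemma lift_orthogonal:
  assumes "harmonic i \<phi>" "harmonic j \<psi>" "i \<noteq> j" "2 * k \<le> n"
  shows "ip k (lift i \<phi>) (lift j \<psi>) = 0"
proof (cases "i \<le> k \<and> j \<le> k")
  case True
  have k: "k + k \<le> n" using assms by simp
  have "ev i k k * ip k (lift i \<phi>) (lift j \<psi>) = ip k (T k k (lift i \<phi>)) (lift j \<psi>)"
    using T_lift_ip[OF assms(1) k] by simp
  also have "\<dots> = ip k (T k k (lift j \<psi>)) (lift i \<phi>)" using ip_T[OF k] ip_commute by simp
  also have "\<dots> = ev j k k * ip k (lift i \<phi>) (lift j \<psi>)"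
    using T_lift_ip[OF assms(2) k] ip_commute by simp
  finally have "(ev i k k - ev j k k) * ip k (lift i \<phi>) (lift j \<psi>) = 0" by (simp add: algebra_simps)
  moreover have "ev i k k \<noteq> ev j k k"
  proof
    assume "ev i k k = ev j k k"
    \<comment> \<open>Absolute values remove the alternating sign; \<open>lam\<close> is strictly
      decreasing up to \<open>k\<close>.\<close>
    then have "\<bar>ev i k k\<bar> = \<bar>ev j k k\<bar>" by simp
    then have "lam k i = lam k j" using lam_nonneg[OF assms(4)] by (simp add: ev_lam abs_mult power_abs)
    then show False using lam_less[OF assms(4)] True assms(3) by (metis less_irrefl nat_neq_iff)
  qed
  ultimately show ?thesis by simp
next
  case False
  then consider "k < i" | "k < j" by linarith
  then show ?thesis
  proof cases
    case 1
    then show ?thesis by (simp add: ip_def lift_above)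
  next
    case 2
    then show ?thesis by (simp add: ip_def lift_above)
  qed
qed

text \<open>By adjointness the squared norm of the image is
  \<open>ev j k l * ev j l k = lam k j * lam l j\<close> times that of the lift; then Cauchy-Schwarz
  applies.\<close>

lemma T_lift_bound:
  assumes "harmonic j \<phi>" "k + l \<le> n" "2 * k \<le> n" "2 * l \<le> n"
  shows "\<bar>ip l (T k l (lift j \<phi>)) g\<bar> \<le> sqrt (lam k j * lam l j) * (sqrt (ip k (lift j \<phi>) (lift j \<phi>)) * sqrt (ip l g g))"
proof -
  let ?f = "lift j \<phi>"
  have "ip l (T k l ?f) (T k l ?f) = ev j k l * ip l ?f (T k l ?f)" by (rule T_lift_ip[OF assms(1,2)])
  also have "ip l ?f (T k l ?f) = ip k (T l k ?f) ?f" using ip_T[of l k] assms(2) by (simp add: add.commute)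
  also have "\<dots> = ev j l k * ip k ?f ?f" using T_lift_ip[OF assms(1)] assms(2) by (simp add: add.commute)
  finally have "ip l (T k l ?f) (T k l ?f) = lam k j * lam l j * ip k ?f ?f"
    by (simp add: ev_mult_ev flip: mult.assoc)
  then show ?thesis using ip_Cauchy_Schwarz[of l "T k l ?f" g] by (simp add: real_sqrt_mult mult.assoc)
qed

end

subsection \<open>The product bound\<close>

lemma weighted_Cauchy_Schwarz:
  fixes X x Y y :: real
  assumes "0 \<le> X" "0 \<le> x" "0 \<le> Y" "0 \<le> y"
  shows "(sqrt X * sqrt Y + sqrt x * sqrt y / 2)\<^sup>2 \<le> (X + x) * (Y + y / 4)"
proof -
  obtain p r u w where e: "X = p\<^sup>2" "x = r\<^sup>2" "Y = u\<^sup>2" "y = w\<^sup>2" "0 \<le> p" "0 \<le> r" "0 \<le> u" "0 \<le> w"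
    using assms by (metis real_sqrt_ge_zero real_sqrt_pow2)
  \<comment> \<open>This square is the difference of the two sides.\<close>
  have "0 \<le> (p * w / 2 - r * u)\<^sup>2" by simp
  then show ?thesis using e by (simp add: power2_eq_square algebra_simps add_divide_distrib)
qed

text \<open>Here \<open>a\<close>, \<open>b\<close> stand for the densities of the two families,
  \<open>X\<close>, \<open>Y\<close> for their energies in degree one, \<open>x\<close>,
  \<open>y\<close> for those in all higher degrees, and \<open>s\<close>, \<open>t\<close> for
  \<open>lam k 1\<close>, \<open>lam l 1\<close>. The hypothesis \<open>self\<close> bounds
  \<open>y\<close> from below and so eliminates it from the second conclusion; the first keeps
  \<open>y\<close> for the case of equality.\<close>

lemma profile_bound:
  fixes a b s t X x Y y :: real
  assumes ab: "0 < a" "0 < b" and st: "0 < s" "0 < t"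
    and nn: "0 \<le> X" "0 \<le> x" "0 \<le> Y" "0 \<le> y"
    and X: "X + x = a * (1 - a)" and Y: "Y + y = b * (1 - b)"
    and cross: "a * b \<le> sqrt (s * t) * (sqrt X * sqrt Y + sqrt x * sqrt y / 2)"
    and self: "t * Y \<le> b\<^sup>2 + t / 2 * y"
  shows "a * b\<^sup>2 \<le> s * t * (1 - a) * (b * (1 - b) - 3 / 4 * y)"
    and "2 * a * b \<le> s * (1 - a) * (b + t * (1 - b))"
proof -
  have "(a * b)\<^sup>2 \<le> (sqrt (s * t) * (sqrt X * sqrt Y + sqrt x * sqrt y / 2))\<^sup>2"
    using cross ab by (intro power_mono) auto
  also have "\<dots> = s * t * (sqrt X * sqrt Y + sqrt x * sqrt y / 2)\<^sup>2"
    using st by (simp add: power_mult_distrib)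
  also have "\<dots> \<le> s * t * ((X + x) * (Y + y / 4))"
    using st by (intro mult_left_mono weighted_Cauchy_Schwarz nn) auto
  also have "Y + y / 4 = b * (1 - b) - 3 / 4 * y" using Y by simp
  finally have "a * (a * b\<^sup>2) \<le> a * (s * t * (1 - a) * (b * (1 - b) - 3 / 4 * y))"
    unfolding X by (simp add: power2_eq_square mult_ac)
  then show 1: "a * b\<^sup>2 \<le> s * t * (1 - a) * (b * (1 - b) - 3 / 4 * y)"
    using ab by (simp only: mult_le_cancel_left_pos)
  have "0 \<le> a * (1 - a)" using X nn by linarith
  then have a1: "0 \<le> 1 - a" using ab by (simp add: zero_le_mult_iff)
  have "Y = b * (1 - b) - y" using Y by simp
  then have "t * (b * (1 - b)) - b\<^sup>2 \<le> 3 / 2 * (t * y)"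
    using self by (simp add: right_diff_distrib)
  moreover have "t * (b * (1 - b) - 3 / 4 * y) = t * (b * (1 - b)) - 3 / 4 * (t * y)"
    by (simp add: algebra_simps)
  moreover have "u - 3 / 4 * w \<le> (u + v) / 2" if "u - v \<le> 3 / 2 * w" for u v w :: real
    using that by (simp add: field_simps)
  ultimately have 2: "t * (b * (1 - b) - 3 / 4 * y) \<le> (t * (b * (1 - b)) + b\<^sup>2) / 2"
    by metis
  have "s * t * (1 - a) * (b * (1 - b) - 3 / 4 * y) = s * (1 - a) * (t * (b * (1 - b) - 3 / 4 * y))"
    by simp
  also have "\<dots> \<le> s * (1 - a) * ((t * (b * (1 - b)) + b\<^sup>2) / 2)"
    using a1 st 2 by (intro mult_left_mono) auto
  finally have "2 * (a * b\<^sup>2) \<le> 2 * (s * (1 - a) * ((t * (b * (1 - b)) + b\<^sup>2) / 2))"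
    using 1 by linarith
  then have "b * (2 * a * b) \<le> b * (s * (1 - a) * (b + t * (1 - b)))"
    by (simp add: power2_eq_square algebra_simps)
  then show "2 * a * b \<le> s * (1 - a) * (b + t * (1 - b))"
    using ab by (simp only: mult_le_cancel_left_pos)
qed

text \<open>The value \<open>t / (1 + t)\<close> is the density of a pencil, that is, of all
  \<open>l\<close>-spaces through a point; \<open>d\<close> says that \<open>b\<close> does not
  exceed it, with deficit \<open>c\<close>. Solved for \<open>a\<close>, the first inequality reads
  \<open>a * D \<le> s * (2 * b + c)\<close>. The product then falls short of \<open>s * t\<close>
  by at least a positive multiple of \<open>c\<close>, so equality forces
  \<open>c = 0\<close>.\<close>

lemma product_bound_aux:
  fixes a b s t :: real
  assumes ab: "0 < a" "0 < b" and st: "0 < s" "0 < t" "t < 1"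
    and 1: "2 * a * b \<le> s * (1 - a) * (b + t * (1 - b))"
    and d: "0 \<le> t - (1 + t) * b"
  shows "(1 + s) * a * ((1 + t) * b) \<le> s * t"
    and "(1 + s) * a * ((1 + t) * b) = s * t \<Longrightarrow> (1 + t) * b = t"
proof -
  define c where "c = t - (1 + t) * b"
  define D where "D = 2 * b + s * (2 * b + c)"
  have c: "0 \<le> c" using d by (simp add: c_def)
  have D: "0 < D" using ab st c by (auto simp: D_def intro!: add_pos_nonneg)
  have "a * D \<le> s * (2 * b + c)" using 1 by (simp add: D_def c_def algebra_simps)
  then have "(1 + s) * ((1 + t) * b) * (a * D) \<le> (1 + s) * ((1 + t) * b) * (s * (2 * b + c))"
    using ab st by (intro mult_left_mono) auto
  also have "\<dots> = s * t * D - s * c * (b * (1 - t) + s * (2 * b + c))"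
    unfolding D_def c_def by algebra
  finally have *: "((1 + s) * a * ((1 + t) * b)) * D + s * c * (b * (1 - t) + s * (2 * b + c)) \<le> s * t * D"
    by (simp add: algebra_simps)
  have p: "0 < b * (1 - t) + s * (2 * b + c)" using ab st c by (intro add_pos_nonneg) auto
  then have "0 \<le> s * c * (b * (1 - t) + s * (2 * b + c))" using st c by simp
  then have "((1 + s) * a * ((1 + t) * b)) * D \<le> s * t * D" using * by linarith
  then show "(1 + s) * a * ((1 + t) * b) \<le> s * t" using D by simp
  assume "(1 + s) * a * ((1 + t) * b) = s * t"
  then have "s * c * (b * (1 - t) + s * (2 * b + c)) \<le> 0" using * by simp
  then have "c \<le> 0" using p st by (simp add: mult_le_0_iff not_le)
  then show "(1 + t) * b = t" using c by (simp add: c_def)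
qed

text \<open>If one density is at most that of a pencil, \<open>product_bound_aux\<close> applies
  with the roles arranged accordingly; both cannot exceed it.\<close>

lemma product_bound:
  fixes a b s t X x Y y :: real
  assumes ab: "0 < a" "0 < b" and st: "0 < s" "s < 1" "0 < t" "t < 1"
    and nn: "0 \<le> X" "0 \<le> x" "0 \<le> Y" "0 \<le> y"
    and X: "X + x = a * (1 - a)" and Y: "Y + y = b * (1 - b)"
    and cross: "a * b \<le> sqrt (s * t) * (sqrt X * sqrt Y + sqrt x * sqrt y / 2)"
    and self: "s * X \<le> a\<^sup>2 + s / 2 * x" "t * Y \<le> b\<^sup>2 + t / 2 * y"
  shows "(1 + s) * a * ((1 + t) * b) \<le> s * t"
    and "(1 + s) * a * ((1 + t) * b) = s * t \<Longrightarrow>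
      (1 + s) * a = s \<and> (1 + t) * b = t \<and> x = 0 \<and> y = 0"
proof -
  note 1 = profile_bound[OF ab st(1,3) nn X Y cross self(2)]
  have cross': "b * a \<le> sqrt (t * s) * (sqrt Y * sqrt X + sqrt y * sqrt x / 2)"
    using cross by (simp add: mult.commute)
  note 2 = profile_bound[OF ab(2,1) st(3,1) nn(3,4,1,2) Y X cross' self(1)]
  have "0 \<le> a * (1 - a)" "0 \<le> b * (1 - b)" using X Y nn by linarith+
  then have le1: "a \<le> 1" "b \<le> 1" using ab by (simp_all add: zero_le_mult_iff)
  consider (b) "0 \<le> t - (1 + t) * b" | (a) "0 \<le> s - (1 + s) * a"
    | (none) "t < (1 + t) * b" "s < (1 + s) * a" by linarith
  note cs = this
  have *: "(1 + s) * a * ((1 + t) * b) \<le> s * t \<and>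
    ((1 + s) * a * ((1 + t) * b) = s * t \<longrightarrow> (1 + s) * a = s \<and> (1 + t) * b = t)"
    using cs
  proof cases
    case b
    note p = product_bound_aux[OF ab st(1,3,4) 1(2) b]
    show ?thesis using p st by auto
  next
    case a
    note p = product_bound_aux[OF ab(2,1) st(3,1,2) 2(2) a]
    show ?thesis using p st by (auto simp: mult.commute)
  next
    case none
    \<comment> \<open>Since \<open>t < (1 + t) * b\<close> means
      \<open>b + t * (1 - b) < 2 * b\<close>, the second profile inequality gives
      \<open>(1 + s) * a \<le> s\<close>, contrary to the case.\<close>
    have "s * (1 - a) * (b + t * (1 - b)) \<le> s * (1 - a) * (2 * b)"
      using none st le1 by (intro mult_left_mono) (auto simp: algebra_simps)
    then have "(2 * b) * a \<le> (2 * b) * (s * (1 - a))" using 1(2) by (simp add: mult_ac)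
    then have "a \<le> s * (1 - a)" using ab by simp
    then show ?thesis using none by (simp add: algebra_simps)
  qed
  then show "(1 + s) * a * ((1 + t) * b) \<le> s * t" by blast
  assume "(1 + s) * a * ((1 + t) * b) = s * t"
  then have e: "(1 + s) * a = s" "(1 + t) * b = t" using * by auto
  \<comment> \<open>At the extremal densities the two sides of the first profile inequality agree
    except for a negative multiple of \<open>y\<close>. The statement is generic because it is used
    for both families.\<close>
  have "y = 0" if "0 < s" "0 < t" "0 \<le> y" "(1 + s) * a = s" "(1 + t) * b = t" "0 < a"
      "a * b\<^sup>2 \<le> s * t * (1 - a) * (b * (1 - b) - 3 / 4 * y)" for s t a b y :: real
  proof -
    have ea: "s * (1 - a) = a" and eb: "t * (1 - b) = b" using that(4,5) by (auto simp: algebra_simps)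
    have "s * t * (1 - a) * (b * (1 - b) - 3 / 4 * y) = (s * (1 - a)) * (b * (t * (1 - b)) - 3 / 4 * (t * y))"
      by (simp add: algebra_simps)
    also have "\<dots> = a * (b\<^sup>2 - 3 / 4 * (t * y))" unfolding ea eb by (simp add: power2_eq_square)
    finally have "a * b\<^sup>2 \<le> a * (b\<^sup>2 - 3 / 4 * (t * y))" using that(7) by simp
    then have "t * y \<le> 0" using that(6) by simp
    then show ?thesis using that by (simp add: mult_le_0_iff)
  qed
  from this[OF st(1,3) nn(4) e ab(1) 1(1)] this[OF st(3,1) nn(2) e(2,1) ab(2) 2(1)] e
  show "(1 + s) * a = s \<and> (1 + t) * b = t \<and> x = 0 \<and> y = 0" by simp
qed

section \<open>Energies of families and the density bound\<close>

context finite_field_space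
begin

definition density :: "nat \<Rightarrow> 'v set set \<Rightarrow> real" where
  "density k F = real (card F) / real (card (S k))"

definition energy :: "nat \<Rightarrow> (nat \<Rightarrow> 'v set \<Rightarrow> real) \<Rightarrow> nat \<Rightarrow> real" where
  "energy k \<Phi> j = ip k (lift j (\<Phi> j)) (lift j (\<Phi> j))"

lemma energy_nonneg: "0 \<le> energy k \<Phi> j"
  by (simp add: energy_def ip_self_nonneg)

lemma sum_le_split:
  fixes h :: "nat \<Rightarrow> real"
  shows "2 \<le> m \<Longrightarrow> (\<Sum>j\<le>m. h j) = h 0 + h 1 + (\<Sum>j=2..m. h j)"
proof -
  assume "2 \<le> m"
  then have "{..m} = {0, 1} \<union> {2..m}" by auto
  then show ?thesis by (simp add: sum.union_disjoint)
qed

lemma card_S_pos: "k \<le> n \<Longrightarrow> 0 < real (card (S k))"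
  unfolding card_S_eq using qcount_pos[of k 0 0] by simp

text \<open>Pairing with the constant function 1 identifies the degree-zero part. The energy
  identity is Parseval, as an indicator equals its square. The last inequality expands the
  nonnegative count of disjoint pairs inside \<open>F\<close>: degree one has multiplier
  \<open>- lam k 1\<close>, and higher degrees have multipliers of absolute value at most
  \<open>lam k 1 / 2\<close>.\<close>

lemma energy_decomposition:
  assumes k: "1 \<le> k" "2 * k \<le> n" and F: "F \<subseteq> S k"
  obtains \<Phi> where "\<And>j. harmonic j (\<Phi> j)"
    "\<And>x. x \<in> S k \<Longrightarrow> of_bool (x \<in> F) = (\<Sum>j\<le>n. lift j (\<Phi> j) x)"
    "\<And>x. subspace x \<Longrightarrow> lift 0 (\<Phi> 0) x = density k F"
    "energy k \<Phi> 1 + (\<Sum>j=2..n. energy k \<Phi> j) = density k F * (1 - density k F)"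
    "lam k 1 * energy k \<Phi> 1 \<le> (density k F)\<^sup>2 + lam k 1 / 2 * (\<Sum>j=2..n. energy k \<Phi> j)"
proof -
  let ?f = "\<lambda>x. of_bool (x \<in> F) :: real"
  let ?c = "density k F"
  have kn: "k \<le> n" "k + k \<le> n" "2 \<le> n" using k by auto
  obtain \<Phi> where \<Phi>: "\<And>j. harmonic j (\<Phi> j)" "\<And>x. x \<in> S k \<Longrightarrow> ?f x = (\<Sum>j\<le>n. lift j (\<Phi> j) x)"
    using harmonic_decomposition[OF kn(1), of ?f] by blast
  define c where "c = \<Phi> 0 {0}"
  have c: "lift 0 (\<Phi> 0) x = c" if "subspace x" for x using lift_0[OF that] by (simp add: c_def)
  note pos = card_S_pos[OF kn(1)]
  have sF: "(\<Sum>x\<in>S k. ?f x) = real (card F)"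
    using F by (simp add: sum.If_cases of_bool_def Int_absorb1)
  have "?c = ip k ?f (\<lambda>_. 1)" using sF by (simp add: ip_def density_def)
  \<comment> \<open>The constant 1 is written as a lift of degree zero so that
    \<open>lift_orthogonal\<close> applies.\<close>
  also have "\<dots> = ip k (\<lambda>x. \<Sum>j\<le>n. lift j (\<Phi> j) x) (lift 0 (\<lambda>_. 1))"
    by (rule ip_cong) (auto simp: \<Phi> lift_0 S_iff)
  also have "\<dots> = (\<Sum>j\<le>n. ip k (lift j (\<Phi> j)) (lift 0 (\<lambda>_. 1)))" by (rule ip_sum_left)
  also have "\<dots> = (\<Sum>j\<le>n. if j = 0 then ip k (lift 0 (\<Phi> 0)) (lift 0 (\<lambda>_. 1)) else 0)"
    by (rule sum.cong) (auto intro!: lift_orthogonal \<Phi> k simp: harmonic_def)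
  also have "\<dots> = ip k (\<lambda>_. c) (\<lambda>_. 1)" by (simp, rule ip_cong) (auto simp: c_def lift_0 S_iff)
  also have "\<dots> = c" using pos by (auto simp: ip_def)
  finally have cc: "c = ?c" ..
  have X0: "energy k \<Phi> 0 = ?c\<^sup>2"
  proof -
    have "energy k \<Phi> 0 = ip k (\<lambda>_. c) (\<lambda>_. c)" unfolding energy_def
      by (rule ip_cong) (auto simp: c S_iff)
    then show ?thesis using pos cc by (auto simp: ip_def power2_eq_square)
  qed
  have "?c = ip k ?f ?f" using sF by (simp add: ip_def density_def)
  also have "\<dots> = ip k (\<lambda>x. \<Sum>j\<le>n. lift j (\<Phi> j) x) (\<lambda>x. \<Sum>j\<le>n. lift j (\<Phi> j) x)"
    by (rule ip_cong) (auto simp: \<Phi>)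
  also have "\<dots> = (\<Sum>i\<le>n. \<Sum>j\<le>n. ip k (lift i (\<Phi> i)) (lift j (\<Phi> j)))"
    by (simp add: ip_sum_left ip_sum_right)
  also have "\<dots> = (\<Sum>i\<le>n. \<Sum>j\<le>n. if j = i then energy k \<Phi> i else 0)"
    by (intro sum.cong) (auto simp: energy_def intro!: lift_orthogonal \<Phi> k)
  also have "\<dots> = (\<Sum>i\<le>n. energy k \<Phi> i)" by simp
  finally have E: "energy k \<Phi> 1 + (\<Sum>j=2..n. energy k \<Phi> j) = ?c * (1 - ?c)"
    using sum_le_split[OF kn(3), of "energy k \<Phi>"] X0 by (simp add: power2_eq_square algebra_simps)
  have "0 \<le> ip k (T k k ?f) ?f"
    unfolding ip_def T_def
    by (intro divide_nonneg_nonneg sum_nonneg mult_nonneg_nonneg) (auto intro!: less_imp_le qcount_pos kn)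
  also have "\<dots> = ip k (\<lambda>y. \<Sum>j\<le>n. T k k (lift j (\<Phi> j)) y) (\<lambda>x. \<Sum>j\<le>n. lift j (\<Phi> j) x)"
  proof (rule ip_cong)
    fix x assume "x \<in> S k"
    have "T k k ?f x = T k k (\<lambda>x. \<Sum>j\<le>n. lift j (\<Phi> j) x) x" by (rule T_cong) (simp add: \<Phi>)
    then show "T k k ?f x = (\<Sum>j\<le>n. T k k (lift j (\<Phi> j)) x)" by (simp add: T_sum)
  qed (simp add: \<Phi>)
  also have "\<dots> = (\<Sum>i\<le>n. \<Sum>j\<le>n. ip k (T k k (lift i (\<Phi> i))) (lift j (\<Phi> j)))"
    by (simp add: ip_sum_left ip_sum_right)
  also have "\<dots> = (\<Sum>i\<le>n. \<Sum>j\<le>n. if j = i then ev i k k * energy k \<Phi> i else 0)"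
    by (intro sum.cong) (auto simp: energy_def T_lift_ip[OF \<Phi>(1) kn(2)] intro!: lift_orthogonal \<Phi> k)
  also have "\<dots> = (\<Sum>i\<le>n. ev i k k * energy k \<Phi> i)" by simp
  also have "\<dots> = ?c\<^sup>2 - lam k 1 * energy k \<Phi> 1 + (\<Sum>i=2..n. ev i k k * energy k \<Phi> i)"
    using sum_le_split[OF kn(3), of "\<lambda>i. ev i k k * energy k \<Phi> i"] X0
    by (simp add: ev_lam lam_0)
  also have "(\<Sum>i=2..n. ev i k k * energy k \<Phi> i) \<le> (\<Sum>i=2..n. lam k 1 / 2 * energy k \<Phi> i)"
  proof (intro sum_mono mult_right_mono energy_nonneg)
    fix i assume "i \<in> {2..n}"
    then have "lam k i \<le> lam k 1 / 2" using lam_le_half k by simp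
    moreover have "ev i k k \<le> \<bar>ev i k k\<bar>" by simp
    moreover have "\<bar>ev i k k\<bar> = lam k i" using lam_nonneg[OF k(2)] by (simp add: ev_lam abs_mult power_abs)
    ultimately show "ev i k k \<le> lam k 1 / 2" by linarith
  qed
  finally have "lam k 1 * energy k \<Phi> 1 \<le> ?c\<^sup>2 + lam k 1 / 2 * (\<Sum>j=2..n. energy k \<Phi> j)"
    by (simp add: sum_distrib_left)
  with \<Phi> c cc E show thesis by (intro that[of \<Phi>]) auto
qed

lemma lam_1: "lam k 1 = (real q ^ k - 1) / (real q ^ n - real q ^ k)"
  by (simp add: lam_def)

lemma lam_1_bounds: "1 \<le> k \<Longrightarrow> 2 * k \<le> n \<Longrightarrow> 0 < lam k 1 \<and> lam k 1 < 1"
  using lam_pos[of k 1] lam_Suc_le[of k 0] by (simp add: lam_0)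

text \<open>The pairing of \<open>T k l\<close> of the first indicator with the second is zero and
  splits by degree into the terms \<open>h j\<close>. Degree zero gives the product of the
  densities, so the other degrees must compensate for it; their size is controlled by
  \<open>T_lift_bound\<close>. The scaling makes a pencil have \<open>a = lam k 1\<close>.\<close>

lemma cross_density:
  assumes k: "1 \<le> k" "2 * k \<le> n" and l: "1 \<le> l" "2 * l \<le> n"
    and F: "F \<subseteq> S k" "F \<noteq> {}" and G: "G \<subseteq> S l" "G \<noteq> {}"
    and cross: "\<And>x y. x \<in> F \<Longrightarrow> y \<in> G \<Longrightarrow> x \<inter> y \<noteq> {0}"
  defines "a \<equiv> (1 + lam k 1) * density k F" and "b \<equiv> (1 + lam l 1) * density l G"
  shows "a * b \<le> lam k 1 * lam l 1"
    and "a * b = lam k 1 * lam l 1 \<Longrightarrow> a = lam k 1 \<and> b = lam l 1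
      \<and> (\<exists>\<phi> c. \<forall>x\<in>S k. of_bool (x \<in> F) = c + lift 1 \<phi> x)
      \<and> (\<exists>\<phi> c. \<forall>x\<in>S l. of_bool (x \<in> G) = c + lift 1 \<phi> x)"
proof -
  let ?f = "\<lambda>x. of_bool (x \<in> F) :: real" and ?g = "\<lambda>x. of_bool (x \<in> G) :: real"
  let ?a = "density k F" and ?b = "density l G"
  have kn: "k + l \<le> n" "2 \<le> n" "k \<le> n" "l \<le> n" using k l by auto
  obtain \<Phi> where \<Phi>: "\<And>j. harmonic j (\<Phi> j)"
    "\<And>x. x \<in> S k \<Longrightarrow> ?f x = (\<Sum>j\<le>n. lift j (\<Phi> j) x)"
    "\<And>x. subspace x \<Longrightarrow> lift 0 (\<Phi> 0) x = density k F"
    "energy k \<Phi> 1 + (\<Sum>j=2..n. energy k \<Phi> j) = density k F * (1 - density k F)"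
    "lam k 1 * energy k \<Phi> 1 \<le> (density k F)\<^sup>2 + lam k 1 / 2 * (\<Sum>j=2..n. energy k \<Phi> j)"
    using energy_decomposition[OF k F(1)] by blast
  obtain \<Psi> where \<Psi>: "\<And>j. harmonic j (\<Psi> j)"
    "\<And>x. x \<in> S l \<Longrightarrow> ?g x = (\<Sum>j\<le>n. lift j (\<Psi> j) x)"
    "\<And>x. subspace x \<Longrightarrow> lift 0 (\<Psi> 0) x = density l G"
    "energy l \<Psi> 1 + (\<Sum>j=2..n. energy l \<Psi> j) = density l G * (1 - density l G)"
    "lam l 1 * energy l \<Psi> 1 \<le> (density l G)\<^sup>2 + lam l 1 / 2 * (\<Sum>j=2..n. energy l \<Psi> j)"
    using energy_decomposition[OF l G(1)] by blast
  let ?X = "energy k \<Phi>" and ?Y = "energy l \<Psi>"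
  define h where "h = (\<lambda>j. ip l (T k l (lift j (\<Phi> j))) (lift j (\<Psi> j)))"
  define \<sigma> where "\<sigma> = sqrt (lam k 1 * lam l 1)"
  have ab: "0 < ?a" "0 < ?b"
    using F G card_S_pos kn by (auto simp: density_def card_gt_0_iff)
  note s = lam_1_bounds[OF k] and t = lam_1_bounds[OF l]
  have hb: "\<bar>h j\<bar> \<le> sqrt (lam k j * lam l j) * (sqrt (?X j) * sqrt (?Y j))" for j
    unfolding h_def energy_def by (rule T_lift_bound[OF \<Phi>(1) kn(1) k(2) l(2)])
  have "T k l ?f y * ?g y = 0" if "y \<in> S l" for y
  proof (cases "y \<in> G")
    case True
    then have "T k l ?f y = 0" using cross by (auto simp: T_def intro!: sum.neutral)
    then show ?thesis by simp
  qed simp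
  then have "(\<Sum>y\<in>S l. T k l ?f y * ?g y) = 0" by (intro sum.neutral) blast
  then have "0 = ip l (T k l ?f) ?g" unfolding ip_def by (simp only: div_0)
  also have "\<dots> = ip l (\<lambda>y. \<Sum>j\<le>n. T k l (lift j (\<Phi> j)) y) (\<lambda>x. \<Sum>j\<le>n. lift j (\<Psi> j) x)"
  proof (rule ip_cong)
    fix x assume "x \<in> S l"
    have "T k l ?f x = T k l (\<lambda>x. \<Sum>j\<le>n. lift j (\<Phi> j) x) x" by (rule T_cong) (simp add: \<Phi>)
    then show "T k l ?f x = (\<Sum>j\<le>n. T k l (lift j (\<Phi> j)) x)" by (simp add: T_sum)
  qed (simp add: \<Psi>)
  also have "\<dots> = (\<Sum>i\<le>n. \<Sum>j\<le>n. ip l (T k l (lift i (\<Phi> i))) (lift j (\<Psi> j)))"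
    by (simp add: ip_sum_left ip_sum_right)
  also have "\<dots> = (\<Sum>i\<le>n. \<Sum>j\<le>n. if j = i then h i else 0)"
  proof (intro sum.cong refl)
    fix i j
    have "ip l (T k l (lift i (\<Phi> i))) (lift j (\<Psi> j)) = 0" if "j \<noteq> i"
      using T_lift_ip[OF \<Phi>(1) kn(1)] lift_orthogonal[OF \<Phi>(1) \<Psi>(1) that[symmetric] l(2)] by simp
    then show "ip l (T k l (lift i (\<Phi> i))) (lift j (\<Psi> j)) = (if j = i then h i else 0)"
      by (auto simp: h_def)
  qed
  also have "\<dots> = (\<Sum>i\<le>n. h i)" by simp
  also have "\<dots> = h 0 + h 1 + (\<Sum>i=2..n. h i)" by (rule sum_le_split[OF kn(2)])
  also have "h 0 = ?a * ?b"
  proof -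
    have "h 0 = ip l (lift 0 (\<Phi> 0)) (lift 0 (\<Psi> 0))"
      unfolding h_def using T_lift_ip[OF \<Phi>(1) kn(1)] by (simp add: ev_def)
    also have "\<dots> = ip l (\<lambda>_. ?a) (\<lambda>_. ?b)" by (rule ip_cong) (auto simp: \<Phi> \<Psi> S_iff)
    also have "\<dots> = ?a * ?b" using card_S_pos[OF kn(4)] by (auto simp: ip_def)
    finally show ?thesis .
  qed
  finally have "?a * ?b \<le> \<bar>h 1\<bar> + (\<Sum>i=2..n. \<bar>h i\<bar>)"
    using sum_abs[of h "{2..n}"] by linarith
  also have "\<bar>h 1\<bar> \<le> \<sigma> * (sqrt (?X 1) * sqrt (?Y 1))" unfolding \<sigma>_def by (rule hb)
  also have "(\<Sum>i=2..n. \<bar>h i\<bar>) \<le> (\<Sum>i=2..n. \<sigma> / 2 * (sqrt (?X i) * sqrt (?Y i)))"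
  proof (rule sum_mono)
    fix i assume i: "i \<in> {2..n}"
    have "lam k i * lam l i \<le> (lam k 1 / 2) * (lam l 1 / 2)"
      using i k l s by (intro mult_mono lam_le_half lam_nonneg) auto
    then have "sqrt (lam k i * lam l i) \<le> sqrt (lam k 1 * lam l 1 / 4)" by simp
    also have "\<dots> = \<sigma> / 2" by (simp add: \<sigma>_def real_sqrt_divide)
    finally have "sqrt (lam k i * lam l i) * (sqrt (?X i) * sqrt (?Y i)) \<le> \<sigma> / 2 * (sqrt (?X i) * sqrt (?Y i))"
      by (intro mult_right_mono) (auto simp: energy_nonneg)
    then show "\<bar>h i\<bar> \<le> \<sigma> / 2 * (sqrt (?X i) * sqrt (?Y i))" using hb[of i] by linarith
  qed
  also have "\<dots> = \<sigma> / 2 * (\<Sum>i=2..n. \<bar>sqrt (?X i)\<bar> * \<bar>sqrt (?Y i)\<bar>)"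
    by (simp add: sum_distrib_left energy_nonneg)
  also have "\<dots> \<le> \<sigma> / 2 * (L2_set (\<lambda>i. sqrt (?X i)) {2..n} * L2_set (\<lambda>i. sqrt (?Y i)) {2..n})"
    using s t by (intro mult_left_mono L2_set_mult_ineq) (auto simp: \<sigma>_def)
  also have "L2_set (\<lambda>i. sqrt (?X i)) {2..n} = sqrt (\<Sum>i=2..n. ?X i)"
    by (simp add: L2_set_def energy_nonneg)
  also have "L2_set (\<lambda>i. sqrt (?Y i)) {2..n} = sqrt (\<Sum>i=2..n. ?Y i)"
    by (simp add: L2_set_def energy_nonneg)
  finally have "?a * ?b \<le> sqrt (lam k 1 * lam l 1) *
      (sqrt (?X 1) * sqrt (?Y 1) + sqrt (\<Sum>i=2..n. ?X i) * sqrt (\<Sum>i=2..n. ?Y i) / 2)"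
    by (simp add: \<sigma>_def algebra_simps)
  note pb = product_bound[OF ab conjunct1[OF s] conjunct2[OF s] conjunct1[OF t] conjunct2[OF t]
      energy_nonneg sum_nonneg[OF energy_nonneg] energy_nonneg sum_nonneg[OF energy_nonneg] \<Phi>(4) \<Psi>(4) this \<Phi>(5) \<Psi>(5)]
  show "a * b \<le> lam k 1 * lam l 1" unfolding a_def b_def by (rule pb(1))
  assume "a * b = lam k 1 * lam l 1"
  note eq = pb(2)[OF this[unfolded a_def b_def]]
  \<comment> \<open>In the case of equality \<open>product_bound\<close> makes the energies of
    degree at least two vanish, and a function of zero energy vanishes on every
    \<open>m\<close>-space.\<close>
  have degree_1: "\<forall>x\<in>S m. of_bool (x \<in> H) = density m H + lift 1 (\<Theta> 1) x"
    if H: "\<And>x. x \<in> S m \<Longrightarrow> of_bool (x \<in> H) = (\<Sum>j\<le>n. lift j (\<Theta> j) x)"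
      "\<And>x. subspace x \<Longrightarrow> lift 0 (\<Theta> 0) x = density m H"
      and 0: "(\<Sum>i=2..n. energy m \<Theta> i) = 0" and m: "m \<le> n" for m H \<Theta>
  proof
    fix x assume x: "x \<in> S m"
    have "lift i (\<Theta> i) x = 0" if "i \<in> {2..n}" for i
    proof -
      have "energy m \<Theta> i = 0" using 0 that by (simp add: sum_nonneg_eq_0_iff energy_nonneg)
      then have "(\<Sum>x\<in>S m. lift i (\<Theta> i) x * lift i (\<Theta> i) x) = 0"
        using card_S_pos[OF m] by (auto simp: energy_def ip_def)
      then show ?thesis using x by (subst (asm) sum_nonneg_eq_0_iff) auto
    qed
    then have "(\<Sum>j\<le>n. lift j (\<Theta> j) x) = lift 0 (\<Theta> 0) x + lift 1 (\<Theta> 1) x"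
      using sum_le_split[OF kn(2), of "\<lambda>j. lift j (\<Theta> j) x"] by simp
    then show "of_bool (x \<in> H) = density m H + lift 1 (\<Theta> 1) x" using H x S_iff by metis
  qed
  have "\<forall>x\<in>S k. of_bool (x \<in> F) = density k F + lift 1 (\<Phi> 1) x"
    using degree_1[of k F \<Phi>] \<Phi>(2,3) eq kn(3) by auto
  moreover have "\<forall>x\<in>S l. of_bool (x \<in> G) = density l G + lift 1 (\<Psi> 1) x"
    using degree_1[of l G \<Psi>] \<Psi>(2,3) eq kn(4) by auto
  ultimately show "a = lam k 1 \<and> b = lam l 1
      \<and> (\<exists>\<phi> c. \<forall>x\<in>S k. of_bool (x \<in> F) = c + lift 1 \<phi> x)
      \<and> (\<exists>\<phi> c. \<forall>x\<in>S l. of_bool (x \<in> G) = c + lift 1 \<phi> x)"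
    using eq unfolding a_def b_def by blast
qed

end

subsection \<open>Uniqueness\<close>

lemma qcount_Suc_left:
  "j < k \<Longrightarrow> qcount q m l j k = (real q ^ m - real q ^ (j + l)) / (real q ^ k - real q ^ j) * qcount q m l (Suc j) k"
  by (simp add: qcount_def prod.atLeast_Suc_lessThan)

text \<open>After an index shift the factor \<open>q^(i + 1)\<close> cancels in each
  quotient.\<close>

lemma gauss_coeff_qcount:
  assumes "1 < q" "1 \<le> k" "k \<le> n"
  shows "gauss_coeff q (n - 1) (k - 1) = qcount q n 0 1 k"
proof -
  have "qcount q n 0 1 k = (\<Prod>i<k - 1. (real q ^ n - real q ^ Suc i) / (real q ^ k - real q ^ Suc i))"
  proof -
    have "{1..<k} = Suc ` {..<k - 1}" using assms by (auto simp: image_Suc_lessThan)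
    then show ?thesis unfolding qcount_def by (simp add: prod.reindex)
  qed
  also have "\<dots> = gauss_coeff q (n - 1) (k - 1)"
    unfolding gauss_coeff_def
  proof (rule prod.cong[OF refl])
    fix i assume i: "i \<in> {..<k - 1}"
    have e: "real q ^ m - real q ^ Suc i = real q ^ Suc i * (real q ^ (m - 1 - i) - 1)" if "i < m" for m
      using that by (simp add: algebra_simps flip: power_add power_Suc)
    show "(real q ^ n - real q ^ Suc i) / (real q ^ k - real q ^ Suc i)
      = (real q ^ (n - 1 - i) - 1) / (real q ^ (k - 1 - i) - 1)"
      using i assms e[of n] e[of k] by simp
  qed
  finally show ?thesis ..
qed

text \<open>Symmetry of the Gaussian coefficients of \<open>2 * k - 1\<close> over \<open>k\<close>
  and \<open>k - 1\<close>: for \<open>n = 2 * k\<close> the two extremal configurations have the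
  same size.\<close>

lemma qcount_hyperplane:
  assumes "1 < q" "1 \<le> k"
  shows "qcount q (2 * k - 1) 0 0 k = qcount q (2 * k) 0 1 k"
proof -
  let ?Q = "real q"
  define m where "m = k - 1"
  have k: "k = Suc m" using assms by (simp add: m_def)
  have "(\<Prod>i<m. ?Q ^ (2 * k) - ?Q ^ Suc i) = ?Q ^ m * (\<Prod>i<m. ?Q ^ (2 * k - 1) - ?Q ^ i)"
  proof -
    have "(\<Prod>i<m. ?Q ^ (2 * k) - ?Q ^ Suc i) = (\<Prod>i<m. ?Q * (?Q ^ (2 * k - 1) - ?Q ^ i))"
      by (rule prod.cong) (simp_all add: k algebra_simps)
    then show ?thesis by (simp add: prod.distrib)
  qed
  moreover have "?Q ^ (2 * k - 1) - ?Q ^ m = ?Q ^ m * (?Q ^ k - 1)"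
    by (simp add: k algebra_simps mult_2_right flip: power_add)
  ultimately have "(\<Prod>i<k. ?Q ^ (2 * k - 1) - ?Q ^ i) = (\<Prod>i<m. ?Q ^ (2 * k) - ?Q ^ Suc i) * (?Q ^ k - 1)"
    unfolding k prod.lessThan_Suc by simp
  moreover have "(\<Prod>i<k. ?Q ^ k - ?Q ^ i) = (?Q ^ k - 1) * (\<Prod>i<m. ?Q ^ k - ?Q ^ Suc i)"
    unfolding k by (subst prod.lessThan_Suc_shift) simp
  moreover have "?Q ^ k - 1 \<noteq> 0"
  proof -
    have "1 < ?Q ^ k" using assms by (intro one_less_power) auto
    then show ?thesis by linarith
  qed
  moreover have "{1..<k} = Suc ` {..<m}" using k by (auto simp: image_Suc_lessThan)
  ultimately show ?thesis by (simp add: qcount_def prod_dividef atLeast0LessThan prod.reindex)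
qed

context finite_field_space
begin

lemma subset_card_eqI: "F \<subseteq> A \<Longrightarrow> card F = card A \<Longrightarrow> F = (A :: 'v set set)"
  by (rule card_subset_eq) auto

lemma ex_between_disjoint:
  assumes "U \<in> S m" "z \<in> S j" "y \<in> S l" "z \<subseteq> U" "y \<subseteq> U" "z \<inter> y = {0}" "j \<le> k" "k + l \<le> m"
  obtains x where "x \<in> S k" "z \<subseteq> x" "x \<subseteq> U" "x \<inter> y = {0}"
proof -
  have "card {x \<in> S k. z \<subseteq> x \<and> x \<subseteq> U \<and> x \<inter> y = {0}} \<noteq> 0"
    using card_between_disjoint[OF assms(1-7)] qcount_pos_ambient[OF assms(8), of j] by (metis less_irrefl of_nat_0)
  then have "{x \<in> S k. z \<subseteq> x \<and> x \<subseteq> U \<and> x \<inter> y = {0}} \<noteq> {}" by (metis card.empty)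
  then show thesis using that by blast
qed

lemma zero_in_S: "x \<in> S m \<Longrightarrow> 0 \<in> x"
  by (simp add: S_iff subspace_0)

lemma card_between:
  assumes "U \<in> S m" "z \<in> S j" "z \<subseteq> U" "j \<le> k"
  shows "real (card {x \<in> S k. z \<subseteq> x \<and> x \<subseteq> U}) = qcount q m 0 j k"
proof -
  have "{x \<in> S k. z \<subseteq> x \<and> x \<subseteq> U \<and> x \<inter> {0} = {0}} = {x \<in> S k. z \<subseteq> x \<and> x \<subseteq> U}"
    using zero_in_S by auto
  then show ?thesis
    using card_between_disjoint[OF assms(1,2), of "{0}" 0 k] assms zero_in_S[OF assms(1)] zero_in_S[OF assms(2)]
    by (simp add: S_0)
qed

lemma card_above: "z \<in> S j \<Longrightarrow> j \<le> k \<Longrightarrow> real (card {x \<in> S k. z \<subseteq> x}) = qcount q n 0 j k"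
  using card_between[OF UNIV_S, of z j k] by simp

section \<open>Points and weights\<close>

lemma span_point: "v \<noteq> 0 \<Longrightarrow> span {v} \<in> S 1"
  using span_insert_subspace[of "{0}" v] by (simp add: subspace_single_0 span_insert_0 insert_commute)

lemma point_eq: "z \<in> S 1 \<Longrightarrow> v \<in> z \<Longrightarrow> v \<noteq> 0 \<Longrightarrow> span {v} = z"
proof -
  assume z: "z \<in> S 1" "v \<in> z" "v \<noteq> 0"
  then have "span {v} \<subseteq> z" by (simp add: S_iff span_minimal)
  then show ?thesis using span_point[OF z(3)] z(1) subspace_dim_equal[of "span {v}" z] by (simp add: S_iff)
qed

lemma span_sub: "subspace x \<Longrightarrow> span {v} \<subseteq> x \<longleftrightarrow> v \<in> x"
  by (metis empty_subsetI insert_subset span_base span_minimal subset_iff singletonI)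

text \<open>Summing over nonzero vectors rather than points turns complements of subspaces into
  plain set differences; every point is counted \<open>q - 1\<close> times.\<close>

definition weight :: "('v set \<Rightarrow> real) \<Rightarrow> 'v set \<Rightarrow> real" where
  "weight \<chi> A = (\<Sum>v\<in>A - {0}. \<chi> (span {v}))"

lemma weight_point: "z \<in> S 1 \<Longrightarrow> weight \<chi> z = (real q - 1) * \<chi> z"
proof -
  assume z: "z \<in> S 1"
  have "weight \<chi> z = (\<Sum>v\<in>z - {0}. \<chi> z)"
    unfolding weight_def by (rule sum.cong) (auto simp: point_eq[OF z])
  moreover have "card (z - {0}) = q - 1"
    using card_S[OF z] zero_in_S[OF z] by (simp add: card_Diff_subset)
  ultimately show ?thesis using q_gt_1 by (simp add: of_nat_diff)
qed

lemma lift_1_weight: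
  assumes "subspace x" shows "lift 1 \<phi> x = weight (\<lambda>z. \<phi> z / (real q - 1)) x"
proof -
  let ?Z = "{z. z \<in> S 1 \<and> z \<subseteq> x}"
  have U: "x - {0} = (\<Union>z\<in>?Z. z - {0})"
  proof (intro equalityI subsetI)
    fix v assume v: "v \<in> x - {0}"
    then have "span {v} \<in> ?Z" "v \<in> span {v}" using span_point span_sub[OF assms] span_base by auto
    then show "v \<in> (\<Union>z\<in>?Z. z - {0})" using v by blast
  qed auto
  have "weight (\<lambda>z. \<phi> z / (real q - 1)) x = (\<Sum>z\<in>?Z. weight (\<lambda>z. \<phi> z / (real q - 1)) z)"
    unfolding weight_def U
  proof (intro sum.UNION_disjoint ballI impI)
    fix z z' assume "z \<in> ?Z" "z' \<in> ?Z" "z \<noteq> z'"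
    then have "\<And>v. v \<in> z \<Longrightarrow> v \<in> z' \<Longrightarrow> v \<noteq> 0 \<Longrightarrow> False" using point_eq by blast
    then show "(z - {0}) \<inter> (z' - {0}) = {}" by blast
  qed simp_all
  also have "\<dots> = lift 1 \<phi> x"
    unfolding lift_def using q_gt_1 weight_point[of _ "\<lambda>z. \<phi> z / (real q - 1)"]
    by (intro sum.cong) auto
  finally show ?thesis ..
qed

lemma weight_mono_Diff: "A \<subseteq> B \<Longrightarrow> 0 \<in> A \<Longrightarrow> weight \<chi> B = weight \<chi> A + (\<Sum>v\<in>B - A. \<chi> (span {v}))"
proof -
  assume *: "A \<subseteq> B" "0 \<in> A"
  then have "B - {0} = (A - {0}) \<union> (B - A)" by blast
  then show ?thesis unfolding weight_def using * by (simp only:) (intro sum.union_disjoint, auto)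
qed

text \<open>Exchange the sums: a vector of \<open>z\<close> lies in all of the
  \<open>k\<close>-spaces, a vector of \<open>U - z\<close> in \<open>?D\<close> of them. The
  fraction multiplying the weight of \<open>z\<close> is \<open>?C / ?D - 1\<close>.\<close>

lemma sum_weight_between:
  assumes "U \<in> S m" "z \<in> S j" "z \<subseteq> U" "j < k"
  shows "(\<Sum>x | x \<in> S k \<and> z \<subseteq> x \<and> x \<subseteq> U. weight \<chi> x)
    = qcount q m 0 (Suc j) k * (weight \<chi> U + weight \<chi> z * (real q ^ m - real q ^ k) / (real q ^ k - real q ^ j))"
proof -
  let ?X = "{x. x \<in> S k \<and> z \<subseteq> x \<and> x \<subseteq> U}"
  let ?C = "qcount q m 0 j k" and ?D = "qcount q m 0 (Suc j) k"
  have sz: "subspace z" "dim z = j" "subspace U" using assms by (auto simp: S_iff)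
  have c1: "real (card {x. x \<in> ?X \<and> v \<in> x}) = ?C" if "v \<in> z" for v
  proof -
    have "{x. x \<in> ?X \<and> v \<in> x} = {x \<in> S k. z \<subseteq> x \<and> x \<subseteq> U}" using that by blast
    then show ?thesis using card_between[OF assms(1-3), of k] assms(4) by simp
  qed
  have c2: "real (card {x. x \<in> ?X \<and> v \<in> x}) = ?D" if "v \<in> U - z" for v
  proof -
    have "{x. x \<in> ?X \<and> v \<in> x} = {x \<in> S k. span (insert v z) \<subseteq> x \<and> x \<subseteq> U}"
    proof -
      have "z \<subseteq> x \<and> v \<in> x \<longleftrightarrow> span (insert v z) \<subseteq> x" if "subspace x" for x
        using that by (metis insert_subset span_minimal span_superset subset_trans)
      then show ?thesis by (auto simp: S_iff)
    qed
    moreover have "span (insert v z) \<in> S (Suc j)" using span_insert_subspace[of z v] sz that by simp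
    moreover have "span (insert v z) \<subseteq> U" using that assms sz by (intro span_minimal) auto
    ultimately show ?thesis using card_between[OF assms(1), of "span (insert v z)" "Suc j" k] assms(4) by simp
  qed
  have "(\<Sum>x\<in>?X. weight \<chi> x) = (\<Sum>x\<in>?X. \<Sum>v | v \<in> U - {0} \<and> v \<in> x. \<chi> (span {v}))"
    unfolding weight_def by (intro sum.cong) auto
  also have "\<dots> = (\<Sum>v\<in>U - {0}. \<Sum>x | x \<in> ?X \<and> v \<in> x. \<chi> (span {v}))"
    by (rule sum.swap_restrict) auto
  also have "\<dots> = (\<Sum>v\<in>U - {0}. real (card {x. x \<in> ?X \<and> v \<in> x}) * \<chi> (span {v}))" by simp
  also have "\<dots> = (\<Sum>v\<in>z - {0}. real (card {x. x \<in> ?X \<and> v \<in> x}) * \<chi> (span {v}))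
     + (\<Sum>v\<in>U - z. real (card {x. x \<in> ?X \<and> v \<in> x}) * \<chi> (span {v}))"
  proof -
    have "U - {0} = (z - {0}) \<union> (U - z)" using assms zero_in_S by blast
    then show ?thesis by (simp only:) (intro sum.union_disjoint, use zero_in_S[OF assms(2)] in auto)
  qed
  also have "(\<Sum>v\<in>z - {0}. real (card {x. x \<in> ?X \<and> v \<in> x}) * \<chi> (span {v})) = ?C * weight \<chi> z"
    unfolding weight_def sum_distrib_left by (rule sum.cong) (use c1 in auto)
  also have "(\<Sum>v\<in>U - z. real (card {x. x \<in> ?X \<and> v \<in> x}) * \<chi> (span {v})) = ?D * (\<Sum>v\<in>U - z. \<chi> (span {v}))"
    unfolding sum_distrib_left by (rule sum.cong) (use c2 in auto)
  also have "(\<Sum>v\<in>U - z. \<chi> (span {v})) = weight \<chi> U - weight \<chi> z"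
    using weight_mono_Diff[OF assms(3) zero_in_S[OF assms(2)], of \<chi>] by simp
  also have "?C = (real q ^ m - real q ^ j) / (real q ^ k - real q ^ j) * ?D"
    using qcount_Suc_left[OF assms(4), of q m 0] by simp
  finally show ?thesis using qpow_less[OF assms(4)] by (simp add: field_simps)
qed

end

section \<open>Families of pencil size whose indicator has degree at most one\<close>

locale degree_one_family = finite_field_space scale Basis q n
  for scale :: "'k::{field,finite} \<Rightarrow> 'v::ab_group_add \<Rightarrow> 'v" and Basis q n +
  fixes k :: nat and F :: "'v set set" and \<chi> :: "'v set \<Rightarrow> real"
  assumes k: "1 \<le> k" "2 * k \<le> n" and F: "F \<subseteq> S k"
    and card_F: "real (card F) = qcount q n 0 1 k"
    and indicator_F: "\<And>x. x \<in> S k \<Longrightarrow> of_bool (x \<in> F) = weight \<chi> x"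
begin

lemma sum_weight_card: "real (card {x \<in> F. P x}) = (\<Sum>x | x \<in> S k \<and> P x. weight \<chi> x)"
proof -
  have "(\<Sum>x | x \<in> S k \<and> P x. weight \<chi> x) = (\<Sum>x | x \<in> S k \<and> P x. of_bool (x \<in> F))"
    by (rule sum.cong) (auto simp: indicator_F)
  also have "\<dots> = (\<Sum>x\<in>{x \<in> S k. P x} \<inter> F. 1)"
    by (simp add: sum.If_cases of_bool_def)
  also have "{x \<in> S k. P x} \<inter> F = {x \<in> F. P x}" using F by blast
  finally show ?thesis by simp
qed

lemma weight_UNIV: "weight \<chi> UNIV = 1"
proof -
  \<comment> \<open>With \<open>z = {0}\<close>, of weight zero, the average runs over all
    \<open>k\<close>-spaces.\<close>
  have "real (card {x \<in> F. {0} \<subseteq> x \<and> x \<subseteq> UNIV}) = qcount q n 0 1 k * weight \<chi> UNIV"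
    using sum_weight_between[OF UNIV_S, of "{0}" 0 k \<chi>] k S_0 unfolding sum_weight_card
    by (simp add: weight_def)
  moreover have "{x \<in> F. {0} \<subseteq> x \<and> x \<subseteq> UNIV} = F" using F zero_in_S by blast
  ultimately show ?thesis using card_F qcount_pos[of k 0 1] k by simp
qed

lemma F_nonempty: "F \<noteq> {}"
  using card_F qcount_pos[of k 0 1] k by auto

lemma weight_F: "x \<in> F \<Longrightarrow> weight \<chi> x = 1"
  using F indicator_F[of x] by auto

definition \<delta> :: real where "\<delta> = (real q ^ k - real q) / (real q ^ n - real q ^ k)"

text \<open>By averaging over the \<open>k\<close>-spaces through the point, the number of members
  of \<open>F\<close> containing \<open>v\<close> is a positive multiple of its weight plus
  \<open>\<delta>\<close>.\<close>

lemma weight_point_ge: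
  assumes "2 \<le> k" "v \<noteq> 0"
  shows "- \<delta> \<le> weight \<chi> (span {v})" and "weight \<chi> (span {v}) = - \<delta> \<longleftrightarrow> v \<notin> \<Union>F"
proof -
  let ?p = "span {v}"
  have lt: "0 < real q ^ k - real q" "0 < real q ^ n - real q ^ k"
    using qpow_less[of 1 k] qpow_less[of k n] assms k by auto
  have p: "?p \<in> S 1" using assms span_point by blast
  have "?p \<subseteq> x \<longleftrightarrow> v \<in> x" if "x \<in> F" for x
    using subsetD[OF F that] by (intro span_sub) (simp add: S_iff)
  then have e: "{x \<in> F. ?p \<subseteq> x \<and> x \<subseteq> UNIV} = {x \<in> F. v \<in> x}" by (simp cong: conj_cong)
  have "real (card {x \<in> F. v \<in> x}) = qcount q n 0 2 k * (1 + weight \<chi> ?p * (real q ^ n - real q ^ k) / (real q ^ k - real q))"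
    using sum_weight_between[OF UNIV_S p, of k \<chi>] assms weight_UNIV sum_weight_card[of "\<lambda>x. ?p \<subseteq> x \<and> x \<subseteq> UNIV"] unfolding e
    by (simp add: numeral_2_eq_2)
  also have "1 + weight \<chi> ?p * (real q ^ n - real q ^ k) / (real q ^ k - real q)
     = (weight \<chi> ?p + \<delta>) * ((real q ^ n - real q ^ k) / (real q ^ k - real q))"
  proof -
    have "1 + w * N / P = (w + P / N) * (N / P)" if "0 < P" "0 < N" for w N P :: real
      using that by (simp add: distrib_right add_divide_distrib)
    from this[OF lt] show ?thesis unfolding \<delta>_def .
  qed
  finally have *: "real (card {x \<in> F. v \<in> x}) = (weight \<chi> ?p + \<delta>) *
      (qcount q n 0 2 k * ((real q ^ n - real q ^ k) / (real q ^ k - real q)))"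
    by (simp only: mult_ac)
  have c: "0 < qcount q n 0 2 k * ((real q ^ n - real q ^ k) / (real q ^ k - real q))"
    using lt qcount_pos[of k 0 2] k by simp
  have "0 \<le> (weight \<chi> ?p + \<delta>) * (qcount q n 0 2 k * ((real q ^ n - real q ^ k) / (real q ^ k - real q)))"
    unfolding *[symmetric] by simp
  then have "0 \<le> weight \<chi> ?p + \<delta>" using c by (simp only: zero_le_mult_iff) auto
  then show "- \<delta> \<le> weight \<chi> ?p" by linarith
  have "v \<notin> \<Union>F \<longleftrightarrow> {x \<in> F. v \<in> x} = {}" by blast
  also have "\<dots> \<longleftrightarrow> card {x \<in> F. v \<in> x} = 0" by (simp only: card_eq_0_iff) simp
  also have "\<dots> \<longleftrightarrow> real (card {x \<in> F. v \<in> x}) = 0" by (rule of_nat_eq_0_iff[symmetric])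
  also have "\<dots> \<longleftrightarrow> weight \<chi> ?p + \<delta> = 0"
    unfolding * using c by (metis less_irrefl mult_eq_0_iff)
  finally show "weight \<chi> ?p = - \<delta> \<longleftrightarrow> v \<notin> \<Union>F" by (simp only: add_eq_0_iff2)
qed

text \<open>Averaging over the \<open>k\<close>-spaces through an uncovered point \<open>p\<close> inside \<open>x + p\<close> fixes the
  total weight of \<open>x + p\<close>, and this is so small that all vectors of \<open>x + p\<close> outside \<open>x\<close> must have
  the least possible weight.\<close>

lemma uncovered:
  assumes "2 \<le> k" "v \<notin> \<Union>F" "x \<in> F"
  shows "n = 2 * k" and "span (insert v x) - x \<subseteq> - \<Union>F"
proof -
  let ?p = "span {v}" and ?u = "span (insert v x)" and ?Q = "real q"
  have x: "x \<in> S k" "subspace x" "dim x = k" using assms F by (auto simp: S_iff)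
  have v: "v \<notin> x" "v \<noteq> 0" using assms zero_in_S[OF x(1)] by auto
  have lt: "0 < ?Q ^ k - ?Q" "0 < ?Q ^ n - ?Q ^ k"
    using qpow_less[of 1 k] qpow_less[of k n] assms k by auto
  have p: "?p \<in> S 1" using v span_point by blast
  have u: "?u \<in> S (Suc k)" using span_insert_subspace[OF x(2) v(1)] x by simp
  have pu: "?p \<subseteq> ?u" by (rule span_mono) simp
  have xu: "x \<subseteq> ?u" using span_superset by blast
  have wp: "weight \<chi> ?p = - \<delta>" using assms(2) weight_point_ge(2)[OF assms(1) v(2)] by simp
  have "weight \<chi> y = 0" if "y \<in> S k" "?p \<subseteq> y" for y
  proof -
    have "v \<in> y" using that span_sub S_iff by blast
    then have "y \<notin> F" using assms by blast
    then show ?thesis using indicator_F[OF that(1)] by simp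
  qed
  then have "(\<Sum>y | y \<in> S k \<and> ?p \<subseteq> y \<and> y \<subseteq> ?u. weight \<chi> y) = 0" by (intro sum.neutral) blast
  then have "qcount q (Suc k) 0 2 k * (weight \<chi> ?u + - \<delta> * (?Q ^ Suc k - ?Q ^ k) / (?Q ^ k - ?Q)) = 0"
    using sum_weight_between[OF u p pu, of k \<chi>] assms(1) wp by (simp add: numeral_2_eq_2)
  then have "weight \<chi> ?u = \<delta> * (?Q ^ Suc k - ?Q ^ k) / (?Q ^ k - ?Q)"
    using qcount_pos_ambient[of k 0 "Suc k" 2] by simp
  also have "\<dots> = (?Q ^ Suc k - ?Q ^ k) / (?Q ^ n - ?Q ^ k)" using lt by (simp add: \<delta>_def)
  finally have wu: "weight \<chi> ?u = (?Q ^ Suc k - ?Q ^ k) / (?Q ^ n - ?Q ^ k)" .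
  have cu: "real (card (?u - x)) = ?Q ^ k * (?Q - 1)"
  proof -
    have "card (?u - x) + card x = card ?u"
      using xu by (simp add: card_Diff_subset card_mono)
    then have "real (card (?u - x)) + real (card x) = real (card ?u)" by linarith
    then show ?thesis by (simp add: card_S[OF u] card_S[OF x(1)] algebra_simps)
  qed
  have q1: "0 < ?Q - 1" using q_gt_1 by simp
  \<comment> \<open>The excess of one vector over its least value: weight \<open>- \<delta>\<close>
    of a point is shared by \<open>q - 1\<close> vectors.\<close>
  let ?t = "\<lambda>w. \<chi> (span {w}) + \<delta> / (?Q - 1)"
  have w0: "w \<noteq> 0" if "w \<in> ?u - x" for w using that zero_in_S[OF x(1)] by auto
  have wt: "weight \<chi> (span {w}) = (?Q - 1) * \<chi> (span {w})" if "w \<in> ?u - x" for w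
    by (rule weight_point[OF span_point[OF w0[OF that]]])
  have t: "0 \<le> ?t w" if "w \<in> ?u - x" for w
  proof -
    have "- \<delta> \<le> (?Q - 1) * \<chi> (span {w})"
      using weight_point_ge(1)[OF assms(1) w0[OF that]] unfolding wt[OF that] .
    then have "- \<delta> / (?Q - 1) \<le> \<chi> (span {w})" 
      by (subst pos_divide_le_eq[OF q1]) (simp only: mult.commute)
    then show ?thesis by simp
  qed
  have "(\<Sum>w\<in>?u - x. ?t w) = (\<Sum>w\<in>?u - x. \<chi> (span {w})) + ?Q ^ k * \<delta>"
    unfolding sum.distrib sum_constant cu using q1 by simp
  also have "(\<Sum>w\<in>?u - x. \<chi> (span {w})) = weight \<chi> ?u - 1"
    using weight_mono_Diff[OF xu zero_in_S[OF x(1)], of \<chi>] weight_F[OF assms(3)] by simp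
  also have "weight \<chi> ?u - 1 + ?Q ^ k * \<delta> = (?Q ^ (2 * k) - ?Q ^ n) / (?Q ^ n - ?Q ^ k)"
  proof -
    have "(Q * a - a) / D - 1 + a * ((a - Q) / D) = (a * a - (a + D)) / D" if "0 < D" for Q a D :: real
      using that by (simp add: diff_divide_distrib add_divide_distrib right_diff_distrib mult.commute)
    from this[OF lt(2), of ?Q "?Q ^ k"] show ?thesis
      unfolding wu \<delta>_def by (simp add: mult_2 power_add)
  qed
  finally have s: "(\<Sum>w\<in>?u - x. ?t w) = (?Q ^ (2 * k) - ?Q ^ n) / (?Q ^ n - ?Q ^ k)" .
  \<comment> \<open>The sum is nonnegative termwise, but \<open>n \<ge> 2 * k\<close> makes its
    value nonpositive; hence both are zero.\<close>
  have "0 \<le> (\<Sum>w\<in>?u - x. ?t w)" using t by (rule sum_nonneg)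
  then have "?Q ^ n \<le> ?Q ^ (2 * k)" unfolding s using lt by (simp add: zero_le_divide_iff)
  then show n: "n = 2 * k" using k q_gt_1 by simp
  have "(\<Sum>w\<in>?u - x. ?t w) = 0" unfolding s by (simp add: n)
  then have t0: "\<forall>w\<in>?u - x. ?t w = 0"
    by (subst (asm) sum_nonneg_eq_0_iff[OF finite_space t])
  have "weight \<chi> (span {w}) = - \<delta>" if w: "w \<in> ?u - x" for w
  proof -
    have "?t w = 0" using t0 w by (rule bspec)
    then have "\<chi> (span {w}) = - (\<delta> / (?Q - 1))" by simp
    then show ?thesis unfolding wt[OF w] using q1 by simp
  qed
  then show "?u - x \<subseteq> - \<Union>F" using weight_point_ge(2)[OF assms(1) w0] by (intro subsetI ComplI) metis
qed

text \<open>The union of \<open>F\<close> is closed under addition: if \<open>a\<close> lies in a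
  member \<open>x\<close> and \<open>a + b\<close> is uncovered, then \<open>b\<close> lies either
  in \<open>x\<close>, which is absurd, or in \<open>span (insert (a + b) x) - x\<close>, which is
  uncovered. This proper subspace extends to a hyperplane, and the sizes agree.\<close>

lemma hyperplane_of_uncovered:
  assumes "2 \<le> k" "v \<notin> \<Union>F"
  shows "n = 2 * k \<and> (\<exists>H\<in>S (2 * k - 1). F = {x \<in> S k. x \<subseteq> H})"
proof -
  have n: "n = 2 * k" using F_nonempty uncovered(1)[OF assms] by blast
  have sub: "subspace (\<Union>F)"
  proof (rule subspaceI)
    show "0 \<in> \<Union>F" using F_nonempty F zero_in_S by blast
  next
    fix a b assume a: "a \<in> \<Union>F" and b: "b \<in> \<Union>F"
    show "a + b \<in> \<Union>F"
    proof (rule ccontr)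
      assume c: "a + b \<notin> \<Union>F"
      obtain x where x: "x \<in> F" "a \<in> x" using a by blast
      then have sx: "subspace x" using F S_iff by blast
      have "b \<notin> x" using c x sx subspace_add by blast
      moreover have "b \<in> span (insert (a + b) x)"
      proof -
        have "(a + b) - a \<in> span (insert (a + b) x)" using x by (intro span_diff span_base) auto
        then show ?thesis by simp
      qed
      ultimately show False using uncovered(2)[OF assms(1) c x(1)] b by blast
    qed
  next
    fix c a assume "a \<in> \<Union>F"
    then obtain x where x: "x \<in> F" "a \<in> x" by blast
    then have "subspace x" using F by (auto simp: S_iff)
    then have "scale c a \<in> x" using x(2) by (rule subspace_scale)
    then show "scale c a \<in> \<Union>F" using x(1) by (rule UnionI[rotated])
  qed
  have "\<Union>F \<in> S (dim (\<Union>F))" using sub by (simp add: S_iff)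
  moreover have "dim (\<Union>F) \<le> n - 1"
  proof -
    have "\<Union>F \<noteq> UNIV" using assms(2) by blast
    then have "dim (\<Union>F) \<noteq> n" 
      using subspace_dim_equal[OF sub subspace_UNIV subset_UNIV] by (metis dim_UNIV_n order_refl)
    then show ?thesis using dim_le_n[of "\<Union>F"] by simp
  qed
  moreover have z: "\<Union>F \<inter> {0} = {0}" "{0} \<in> S 0" "n - 1 + 0 \<le> n" using sub subspace_0 S_0 by auto
  ultimately obtain H where H: "H \<in> S (n - 1)" "\<Union>F \<subseteq> H"
    using ex_between_disjoint[OF UNIV_S _ z(2) subset_UNIV subset_UNIV z(1) _ z(3)] by metis
  have "real (card {x \<in> S k. {0} \<subseteq> x \<and> x \<subseteq> H}) = qcount q (n - 1) 0 0 k"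
    using H zero_in_S by (intro card_between) (auto simp: S_0)
  moreover have "{x \<in> S k. {0} \<subseteq> x \<and> x \<subseteq> H} = {x \<in> S k. x \<subseteq> H}" using zero_in_S by blast
  ultimately have "real (card F) = real (card {x \<in> S k. x \<subseteq> H})"
    using card_F qcount_hyperplane[OF q_gt_1 k(1)] n by simp
  then have "F = {x \<in> S k. x \<subseteq> H}" using H F by (intro subset_card_eqI) auto
  then show ?thesis using H n by auto
qed

lemma pencil_of_common:
  assumes "z \<in> S 1" "\<And>x. x \<in> F \<Longrightarrow> z \<subseteq> x"
  shows "F = {x \<in> S k. z \<subseteq> x}"
  using assms F card_F card_above[OF assms(1) k(1)] by (intro subset_card_eqI) auto

text \<open>Choose a complement \<open>c\<close> of the point \<open>p\<close> in \<open>x\<close>. Summing the weights of all \<open>k\<close>-spaces \<open>y\<close>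
  with \<open>y \<inter> x = p\<close>, that is \<open>p \<subseteq> y\<close> and \<open>y \<inter> c = 0\<close>, leaves a positive multiple of the weight of
  \<open>p\<close>, because the weight outside \<open>x\<close> is zero.\<close>

lemma weight_covered_nonneg:
  assumes "2 \<le> k" "x \<in> F" "v \<in> x" "v \<noteq> 0"
  shows "0 \<le> weight \<chi> (span {v})"
proof -
  let ?p = "span {v}"
  have x: "x \<in> S k" "subspace x" using assms F by (auto simp: S_iff)
  have p: "?p \<in> S 1" "subspace ?p" using assms span_point by auto
  have px: "?p \<subseteq> x" using span_sub x assms by blast
  have z: "{0} \<in> S 0" "{0} \<subseteq> x" "{0} \<inter> ?p = {0}" "k - 1 + 1 \<le> k"
    using S_0 zero_in_S[OF x(1)] zero_in_S[OF p(1)] assms(1) by auto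
  obtain c where c: "c \<in> S (k - 1)" "{0} \<subseteq> c" "c \<subseteq> x" "c \<inter> ?p = {0}"
    by (rule ex_between_disjoint[OF x(1) z(1) p(1) z(2) px z(3) le0 z(4)])
  have sc: "subspace c" "dim c = k - 1" using c(1) by (simp_all add: S_iff)
  have x_eq: "x = {a + b |a b. a \<in> ?p \<and> b \<in> c}"
  proof -
    have "dim {a + b |a b. a \<in> ?p \<and> b \<in> c} = k"
      using dim_sums_Int[OF p(2) sc(1)] p(1) c(4) assms(1) sc(2) by (simp add: S_iff Int_commute)
    moreover have "{a + b |a b. a \<in> ?p \<and> b \<in> c} \<subseteq> x"
      using px c(3) subspace_add[OF x(2)] by auto
    ultimately show ?thesis using subspace_dim_equal[OF subspace_sums[OF p(2) sc(1)] x(2)] x(1) by (simp add: S_iff)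
  qed
  have cn: "(k - 1) + k \<le> n" "k + (k - 1) \<le> n" using k by auto
  let ?Y = "{y. y \<in> S k \<and> ?p \<subseteq> y \<and> y \<inter> c = {0}}"
  let ?N = "\<lambda>w. real (card {y. y \<in> ?Y \<and> w \<in> y})"
  have N1: "?N w = qcount q n (k - 1) 1 k" if "w \<in> ?p" for w
  proof -
    have "{y. y \<in> ?Y \<and> w \<in> y} = {y \<in> S k. ?p \<subseteq> y \<and> y \<inter> c = {0}}" using that by blast
    then show ?thesis using card_disjoint_above[OF p(1) c(1) k(1)] c(4) by (simp add: Int_commute)
  qed
  have N: "?N w = (if span (insert w ?p) \<inter> c = {0} then qcount q n (k - 1) 2 k else 0)" if "w \<notin> ?p" for w
  proof -
    have "?p \<subseteq> y \<and> w \<in> y \<longleftrightarrow> span (insert w ?p) \<subseteq> y" if "subspace y" for y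
      using that by (metis insert_subset span_minimal span_superset subset_trans)
    then have "{y. y \<in> ?Y \<and> w \<in> y} = {y \<in> S k. span (insert w ?p) \<subseteq> y \<and> y \<inter> c = {0}}"
      by (auto simp: S_iff)
    moreover have "span (insert w ?p) \<in> S 2" using span_insert_subspace[OF p(2) that] p by (simp add: S_iff numeral_2_eq_2)
    ultimately show ?thesis using card_disjoint_above[of "span (insert w ?p)" 2 c "k - 1" k] c(1) assms(1) by simp
  qed
  \<comment> \<open>Such a \<open>w\<close> has a nonzero component in \<open>c\<close>, so the span
    of \<open>w\<close> and the point already meets \<open>c\<close>.\<close>
  have N0: "?N w = 0" if w: "w \<in> x - ?p" for w
  proof -
    obtain a b where ab: "w = a + b" "a \<in> ?p" "b \<in> c" using w x_eq by blast
    have "w - a \<in> span (insert w ?p)" using ab by (intro span_diff span_base) auto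
    moreover have "b \<noteq> 0" using ab w by auto
    ultimately have "span (insert w ?p) \<inter> c \<noteq> {0}" using ab by auto
    then show ?thesis using N w by simp
  qed
  have N2: "?N w = qcount q n (k - 1) 2 k" if w: "w \<in> UNIV - x" for w
  proof -
    \<comment> \<open>A nonzero coefficient of \<open>w\<close> would put \<open>w\<close> into
      \<open>x\<close>, since \<open>c\<close> and the point lie in \<open>x\<close>; hence
      \<open>u\<close> lies in the point and in \<open>c\<close>.\<close>
    have "u = 0" if u: "u \<in> span (insert w ?p)" "u \<in> c" for u
    proof -
      obtain r where r: "u - scale r w \<in> ?p" using u(1) unfolding span_breakdown_eq[of u w ?p] span_span by blast
      have "r = 0"
      proof (rule ccontr)
        assume r0: "r \<noteq> 0"
        have "u - (u - scale r w) \<in> x"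
          by (rule subspace_diff[OF x(2)]) (use r u(2) c(3) px in blast)+
        then have "scale r w \<in> x" by simp
        then have "scale (inverse r) (scale r w) \<in> x" by (rule subspace_scale[OF x(2)])
        then show False using r0 w by simp
      qed
      then have "u \<in> c \<inter> ?p" using r u(2) by simp
      then show ?thesis unfolding c(4) by simp
    qed
    moreover have "0 \<in> c" using c(2) by simp
    ultimately have "span (insert w ?p) \<inter> c = {0}" using span_zero by blast
    moreover have "w \<notin> ?p" using w px by blast
    ultimately show ?thesis using N[of w] by simp
  qed
  have "real (card {y \<in> F. ?p \<subseteq> y \<and> y \<inter> c = {0}}) = (\<Sum>y\<in>?Y. weight \<chi> y)" by (rule sum_weight_card)
  also have "\<dots> = (\<Sum>y\<in>?Y. \<Sum>w | w \<in> UNIV - {0} \<and> w \<in> y. \<chi> (span {w}))"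
    unfolding weight_def by (intro sum.cong) auto
  also have "\<dots> = (\<Sum>w\<in>UNIV - {0}. \<Sum>y | y \<in> ?Y \<and> w \<in> y. \<chi> (span {w}))"
    by (rule sum.swap_restrict) auto
  also have "\<dots> = (\<Sum>w\<in>UNIV - {0}. ?N w * \<chi> (span {w}))" by simp
  also have "\<dots> = (\<Sum>w\<in>?p - {0}. ?N w * \<chi> (span {w})) + (\<Sum>w\<in>x - ?p. ?N w * \<chi> (span {w}))
      + (\<Sum>w\<in>UNIV - x. ?N w * \<chi> (span {w}))"
  proof -
    have 1: "UNIV - {0} = (x - {0}) \<union> (UNIV - x)" "x - {0} = (?p - {0}) \<union> (x - ?p)"
      using zero_in_S[OF x(1)] zero_in_S[OF p(1)] px by blast+
    have "(\<Sum>w\<in>UNIV - {0}. h w) = (\<Sum>w\<in>x - {0}. h w) + (\<Sum>w\<in>UNIV - x. h w)" for h :: "_ \<Rightarrow> real"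
      unfolding 1(1) by (rule sum.union_disjoint) auto
    moreover have "(\<Sum>w\<in>x - {0}. h w) = (\<Sum>w\<in>?p - {0}. h w) + (\<Sum>w\<in>x - ?p. h w)" for h :: "_ \<Rightarrow> real"
      unfolding 1(2) by (rule sum.union_disjoint) auto
    ultimately show ?thesis by presburger
  qed
  also have "(\<Sum>w\<in>?p - {0}. ?N w * \<chi> (span {w})) = qcount q n (k - 1) 1 k * weight \<chi> ?p"
    unfolding weight_def sum_distrib_left by (rule sum.cong) (simp_all only: N1 Diff_iff)
  also have "(\<Sum>w\<in>x - ?p. ?N w * \<chi> (span {w})) = 0"
  proof (intro sum.neutral ballI)
    fix w assume "w \<in> x - ?p"
    then have "?N w = 0" by (rule N0)
    then show "?N w * \<chi> (span {w}) = 0" by (simp only: mult_zero_left)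
  qed
  also have "(\<Sum>w\<in>UNIV - x. ?N w * \<chi> (span {w})) = qcount q n (k - 1) 2 k * (\<Sum>w\<in>UNIV - x. \<chi> (span {w}))"
    unfolding sum_distrib_left by (rule sum.cong) (simp_all only: N2)
  also have "(\<Sum>w\<in>UNIV - x. \<chi> (span {w})) = 0"
    using weight_mono_Diff[OF subset_UNIV zero_in_S[OF x(1)], of \<chi>] weight_UNIV weight_F[OF assms(2)] by simp
  finally have e: "real (card {y \<in> F. ?p \<subseteq> y \<and> y \<inter> c = {0}})
      = qcount q n (k - 1) 1 k * weight \<chi> ?p + 0 + qcount q n (k - 1) 2 k * 0" .
  have "0 \<le> real (card {y \<in> F. ?p \<subseteq> y \<and> y \<inter> c = {0}})" by (rule of_nat_0_le_iff)
  then have "0 \<le> qcount q n (k - 1) 1 k * weight \<chi> ?p" unfolding e by simp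
  then show ?thesis using qcount_pos[OF cn(2), of 1] by (simp only: zero_le_mult_iff) auto
qed

text \<open>All values of \<open>\<chi>\<close> are nonnegative and every member carries the total
  weight 1, so nothing is left outside a member. Any point with nonzero value therefore lies in all
  members.\<close>

lemma pencil_of_covered:
  assumes "2 \<le> k" "\<Union>F = UNIV"
  shows "\<exists>z\<in>S 1. F = {x \<in> S k. z \<subseteq> x}"
proof -
  have nn: "0 \<le> \<chi> (span {v})" if "v \<noteq> 0" for v
  proof -
    obtain x where "x \<in> F" "v \<in> x" using assms(2) by blast
    then have "0 \<le> weight \<chi> (span {v})" using that by (rule weight_covered_nonneg[OF assms(1)])
    then show ?thesis using weight_point[OF span_point[OF that], of \<chi>] q_gt_1 by (simp add: zero_le_mult_iff)
  qed
  have "\<exists>v. v \<noteq> 0 \<and> \<chi> (span {v}) \<noteq> 0"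
  proof (rule ccontr)
    assume "\<not> ?thesis"
    then have "weight \<chi> UNIV = 0" unfolding weight_def by (intro sum.neutral) blast
    then show False using weight_UNIV by simp
  qed
  then obtain v where v: "v \<noteq> 0" "\<chi> (span {v}) \<noteq> 0" by blast
  have "span {v} \<subseteq> x" if x: "x \<in> F" for x
  proof -
    have sx: "x \<in> S k" "subspace x" using x F by (auto simp: S_iff)
    have "(\<Sum>w\<in>UNIV - x. \<chi> (span {w})) = 0"
      using weight_mono_Diff[OF subset_UNIV zero_in_S[OF sx(1)], of \<chi>] weight_UNIV weight_F[OF x] by simp
    moreover have "\<And>w. w \<in> UNIV - x \<Longrightarrow> 0 \<le> \<chi> (span {w})"
      by (rule nn) (use zero_in_S[OF sx(1)] in auto)
    ultimately have "\<forall>w\<in>UNIV - x. \<chi> (span {w}) = 0"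
      by (subst (asm) sum_nonneg_eq_0_iff) (simp_all only: finite_space)
    then have "v \<in> x" using v(2) by blast
    then show ?thesis unfolding span_sub[OF sx(2)] .
  qed
  then have "F = {x \<in> S k. span {v} \<subseteq> x}" by (rule pencil_of_common[OF span_point[OF v(1)]])
  then show ?thesis using span_point[OF v(1)] by (rule bexI)
qed

lemma classification:
  "(\<exists>z\<in>S 1. F = {x \<in> S k. z \<subseteq> x}) \<or> n = 2 * k \<and> (\<exists>z\<in>S (2 * k - 1). F = {x \<in> S k. x \<subseteq> z})"
proof (cases "k = 1")
  case True
  \<comment> \<open>For \<open>k = 1\<close> a pencil is a single point, so the size alone
    decides.\<close>
  have "real (card F) = 1" unfolding card_F True by (simp add: qcount_def)
  then have "card F = 1" by simp
  then obtain z where z: "F = {z}" by (rule card_1_singletonE)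
  have z1: "z \<in> S 1" using F unfolding z True by simp
  have "F = {x \<in> S k. z \<subseteq> x}" by (rule pencil_of_common[OF z1]) (simp add: z)
  then show ?thesis using z1 by blast
next
  case False
  then have k2: "2 \<le> k" using k(1) by simp
  show ?thesis
  proof (cases "\<Union>F = UNIV")
    case True
    show ?thesis by (rule disjI1[OF pencil_of_covered[OF k2 True]])
  next
    case False
    then obtain v where v: "v \<notin> \<Union>F" by blast
    show ?thesis by (rule disjI2[OF hyperplane_of_uncovered[OF k2 v]])
  qed
qed

end

section \<open>The partner family and the final assembly\<close>

context finite_field_space
begin

lemma degree_1_classification:
  assumes k: "1 \<le> k" "2 * k \<le> n" and F: "F \<subseteq> S k" and card: "real (card F) = qcount q n 0 1 k"
    and deg: "\<forall>x\<in>S k. of_bool (x \<in> F) = c + lift 1 \<phi> x"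
  shows "(\<exists>z\<in>S 1. F = {x \<in> S k. z \<subseteq> x}) \<or> n = 2 * k \<and> (\<exists>z\<in>S (2 * k - 1). F = {x \<in> S k. x \<subseteq> z})"
proof -
  \<comment> \<open>Every \<open>k\<close>-space has \<open>q^k - 1\<close> nonzero vectors, so the
    second summand adds exactly \<open>c\<close> to its weight.\<close>
  let ?\<chi> = "\<lambda>z. \<phi> z / (real q - 1) + c / (real q ^ k - 1)"
  have "of_bool (x \<in> F) = weight ?\<chi> x" if x: "x \<in> S k" for x
  proof -
    have "real (card (x - {0})) = real q ^ k - 1"
      using card_S[OF x] zero_in_S[OF x] q_gt_1 by (simp add: card_Diff_subset of_nat_diff)
    moreover have "0 < real q ^ k - 1" using qpow_less[of 0 k] k by simp
    ultimately have "weight ?\<chi> x = weight (\<lambda>z. \<phi> z / (real q - 1)) x + c"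
      unfolding weight_def sum.distrib sum_constant by simp
    then show ?thesis using deg x lift_1_weight[of x \<phi>] S_iff by simp
  qed
  then interpret degree_one_family scale Basis q n k F ?\<chi>
    using k F card by unfold_locales auto
  show ?thesis by (rule classification)
qed

text \<open>If \<open>y\<close> missed \<open>z\<close>, then \<open>k + l \<le> n\<close> would
  leave room for a \<open>k\<close>-space through \<open>z\<close> disjoint from
  \<open>y\<close>.\<close>

lemma partner_of_pencil:
  assumes "1 \<le> k" "1 \<le> l" "k + l \<le> n" and z: "z \<in> S 1" and G: "G \<subseteq> S l" "real (card G) = qcount q n 0 1 l"
    and cross: "\<And>x y. x \<in> S k \<Longrightarrow> z \<subseteq> x \<Longrightarrow> y \<in> G \<Longrightarrow> x \<inter> y \<noteq> {0}"
  shows "G = {x \<in> S l. z \<subseteq> x}"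
proof -
  have "z \<subseteq> y" if y: "y \<in> G" for y
  proof (rule ccontr)
    assume nz: "\<not> z \<subseteq> y"
    have yl: "y \<in> S l" using y G by blast
    have "z \<inter> y = {0}"
    proof -
      have "v = 0" if "v \<in> z" "v \<in> y" for v
        using that nz point_eq[OF z, of v] span_sub[of y v] yl by (auto simp: S_iff)
      then show ?thesis using zero_in_S z yl by blast
    qed
    then obtain x where "x \<in> S k" "z \<subseteq> x" "x \<inter> y = {0}"
      using ex_between_disjoint[OF UNIV_S z yl, of k] assms(1,3) by auto
    then show False using cross y by blast
  qed
  then show ?thesis using G card_above[OF z assms(2)] by (intro subset_card_eqI) auto
qed

lemma card_inside_hyperplane:
  assumes "1 \<le> k" "n = 2 * k" "H \<in> S (2 * k - 1)"
  shows "real (card {x \<in> S k. x \<subseteq> H}) = qcount q n 0 1 k"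
proof -
  have "real (card {x \<in> S k. {0} \<subseteq> x \<and> x \<subseteq> H}) = qcount q (2 * k - 1) 0 0 k"
    using assms zero_in_S by (intro card_between) (auto simp: S_0)
  moreover have "{x \<in> S k. {0} \<subseteq> x \<and> x \<subseteq> H} = {x \<in> S k. x \<subseteq> H}" using zero_in_S by blast
  ultimately show ?thesis using qcount_hyperplane[OF q_gt_1 assms(1)] assms(2) by simp
qed

text \<open>A \<open>k\<close>-space of the \<open>(2 * k - 1)\<close>-space \<open>H\<close> can
  avoid \<open>y \<inter> H\<close> if that has dimension below \<open>k\<close>. So
  \<open>y \<inter> H\<close> has dimension at least \<open>k\<close>, while \<open>y\<close> has
  dimension \<open>l \<le> k\<close>.\<close>

lemma partner_of_hyperplane:
  assumes "1 \<le> k" "n = 2 * k" "2 * l \<le> n" and H: "H \<in> S (2 * k - 1)"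
    and G: "G \<subseteq> S l" "G \<noteq> {}" "real (card G) = qcount q n 0 1 l"
    and cross: "\<And>x y. x \<in> S k \<Longrightarrow> x \<subseteq> H \<Longrightarrow> y \<in> G \<Longrightarrow> x \<inter> y \<noteq> {0}"
  shows "l = k \<and> G = {x \<in> S k. x \<subseteq> H}"
proof -
  have *: "l = k \<and> y \<subseteq> H" if y: "y \<in> G" for y
  proof -
    have sy: "subspace y" "dim y = l" "subspace H" using y G H by (auto simp: S_iff)
    then have yH: "y \<inter> H \<in> S (dim (y \<inter> H))" by (simp add: S_iff subspace_inter)
    have "\<not> dim (y \<inter> H) \<le> k - 1"
    proof
      assume "dim (y \<inter> H) \<le> k - 1"
      then have z: "k + dim (y \<inter> H) \<le> 2 * k - 1" "{0} \<in> S 0" "{0} \<subseteq> H" "{0} \<inter> (y \<inter> H) = {0}"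
        using S_0 zero_in_S[OF H] zero_in_S[OF yH] assms(1) by auto
      obtain x where x: "x \<in> S k" "{0} \<subseteq> x" "x \<subseteq> H" "x \<inter> (y \<inter> H) = {0}"
        by (rule ex_between_disjoint[OF H z(2) yH z(3) Int_lower2 z(4) le0 z(1)])
      have "x \<inter> y = x \<inter> (y \<inter> H)" using x(3) by blast
      then have "x \<inter> y = {0}" using x(4) by simp
      then show False using cross[OF x(1,3) y] by blast
    qed
    moreover have "dim (y \<inter> H) \<le> dim y" by (rule dim_subset) simp
    ultimately have "l = k" "dim y \<le> dim (y \<inter> H)" using sy assms by auto
    then show ?thesis using subspace_dim_equal[of "y \<inter> H" y] sy subspace_inter by blast
  qed
  then have "l = k" using G by blast
  moreover from this have "G = {x \<in> S k. x \<subseteq> H}"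
    using * G card_inside_hyperplane[OF assms(1,2) H] by (intro subset_card_eqI) auto
  ultimately show ?thesis by blast
qed

text \<open>Translates the scaled densities of \<open>cross_density\<close> into sizes relative to a
  pencil.\<close>

lemma scaled_density:
  assumes "1 \<le> k" "2 * k \<le> n"
  shows "(1 + lam k 1) * density k F = lam k 1 * (real (card F) / qcount q n 0 1 k)"
proof -
  have lt: "0 < real q ^ k - 1" "0 < real q ^ n - real q ^ k" "0 < real q ^ n - 1"
    using qpow_less[of 0 k] qpow_less[of k n] qpow_less[of 0 n] assms by auto
  have "real (card (S k)) = (real q ^ n - 1) / (real q ^ k - 1) * qcount q n 0 1 k"
    using card_S_eq[of k] qcount_Suc_left[of 0 k q n 0] assms by simp
  moreover have "1 + lam k 1 = (real q ^ n - 1) / (real q ^ n - real q ^ k)"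
    unfolding lam_1 using lt by (simp add: field_simps)
  ultimately show ?thesis unfolding density_def lam_1 using lt by simp
qed

text \<open>Under equality both families have pencil size. Only \<open>F\<close> is classified by
  its degree; \<open>G\<close> then follows from its size and from meeting every member of
  \<open>F\<close>.\<close>

theorem cross_intersecting:
  fixes k l :: nat and F G :: "'v set set"
  assumes k: "1 \<le> k" "2 * k \<le> n" and l: "1 \<le> l" "2 * l \<le> n"
    and F: "F \<subseteq> S k" and G: "G \<subseteq> S l"
    and cross: "\<And>x y. x \<in> F \<Longrightarrow> y \<in> G \<Longrightarrow> x \<inter> y \<noteq> {0}"
  shows "real (card F) * real (card G) \<le> qcount q n 0 1 k * qcount q n 0 1 l"
    and "real (card F) * real (card G) = qcount q n 0 1 k * qcount q n 0 1 l \<longleftrightarrow>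
      (\<exists>z\<in>S 1. F = {x \<in> S k. z \<subseteq> x} \<and> G = {x \<in> S l. z \<subseteq> x}) \<or>
      n = 2 * k \<and> n = 2 * l \<and> (\<exists>z\<in>S (2 * k - 1). F = {x \<in> S k. x \<subseteq> z} \<and> G = {x \<in> S k. x \<subseteq> z})"
proof -
  let ?A = "qcount q n 0 1 k" and ?B = "qcount q n 0 1 l"
  have kl: "k + l \<le> n" using k l by simp
  have pos: "0 < ?A" "0 < ?B" using qcount_pos[of k 0 1] qcount_pos[of l 0 1] k l by auto
  have "real (card F) * real (card G) \<le> ?A * ?B \<and> (real (card F) * real (card G) = ?A * ?B \<longrightarrow>
      real (card F) = ?A \<and> real (card G) = ?B
      \<and> (\<exists>\<phi> c. \<forall>x\<in>S k. of_bool (x \<in> F) = c + lift 1 \<phi> x))"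
  \<comment> \<open>With an empty family the product is zero and the bound is positive, so equality
    is impossible.\<close>
  proof (cases "F = {} \<or> G = {}")
    case True
    moreover have "0 < ?A * ?B" using pos by simp
    ultimately show ?thesis by auto
  next
    case False
    note cd = cross_density[OF k l F _ G _ cross, unfolded scaled_density[OF k] scaled_density[OF l]]
    have s: "0 < lam k 1" "0 < lam l 1" using lam_1_bounds k l by auto
    have e: "lam k 1 * (real (card F) / ?A) * (lam l 1 * (real (card G) / ?B))
        = (lam k 1 * lam l 1) * ((real (card F) * real (card G)) / (?A * ?B))"
      by simp
    have s2: "0 < lam k 1 * lam l 1" using s by simp
    have cancel: "a = b" if "t * (a / b) = t" "0 < t" "0 < b" for a b t :: real
      using that by (simp add: field_simps)
    have cancel: "a = b" if "t * (a / b) = t" "0 < t" "0 < b" for a b t :: real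
      using that by (simp add: field_simps)
    have "F \<noteq> {}" "G \<noteq> {}" using False by auto
    from cd(1)[OF this] have "(lam k 1 * lam l 1) * ((real (card F) * real (card G)) / (?A * ?B)) \<le> (lam k 1 * lam l 1) * 1"
      unfolding e by simp
    then have "(real (card F) * real (card G)) / (?A * ?B) \<le> 1"
      by (simp only: mult_le_cancel_left_pos[OF s2])
    then have "real (card F) * real (card G) \<le> ?A * ?B" using pos by (simp add: divide_le_eq)
    moreover {
      assume "real (card F) * real (card G) = ?A * ?B"
      then have "lam k 1 * (real (card F) / ?A) * (lam l 1 * (real (card G) / ?B)) = lam k 1 * lam l 1"
        unfolding e using pos by simp
      with cd(2) False have "lam k 1 * (real (card F) / ?A) = lam k 1" "lam l 1 * (real (card G) / ?B) = lam l 1"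
        "\<exists>\<phi> c. \<forall>x\<in>S k. of_bool (x \<in> F) = c + lift 1 \<phi> x" by auto
      then have "real (card F) = ?A \<and> real (card G) = ?B
        \<and> (\<exists>\<phi> c. \<forall>x\<in>S k. of_bool (x \<in> F) = c + lift 1 \<phi> x)"
        using cancel[OF _ s(1) pos(1)] cancel[OF _ s(2) pos(2)] by blast }
    ultimately show ?thesis by blast
  qed
  then have le: "real (card F) * real (card G) \<le> ?A * ?B"
    and eq: "real (card F) * real (card G) = ?A * ?B \<Longrightarrow> real (card F) = ?A \<and> real (card G) = ?B
      \<and> (\<exists>\<phi> c. \<forall>x\<in>S k. of_bool (x \<in> F) = c + lift 1 \<phi> x)" by blast+
  show "real (card F) * real (card G) \<le> ?A * ?B" by (rule le)
  show "real (card F) * real (card G) = ?A * ?B \<longleftrightarrow>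
      (\<exists>z\<in>S 1. F = {x \<in> S k. z \<subseteq> x} \<and> G = {x \<in> S l. z \<subseteq> x}) \<or>
      n = 2 * k \<and> n = 2 * l \<and> (\<exists>z\<in>S (2 * k - 1). F = {x \<in> S k. x \<subseteq> z} \<and> G = {x \<in> S k. x \<subseteq> z})"
    (is "?L \<longleftrightarrow> ?P \<or> ?H")
  proof
    assume ?L
    from eq[OF this] obtain \<phi> c where c: "real (card F) = ?A" "real (card G) = ?B"
      "\<forall>x\<in>S k. of_bool (x \<in> F) = c + lift 1 \<phi> x" by blast
    from degree_1_classification[OF k F c(1,3)] show "?P \<or> ?H"
    proof
      assume "\<exists>z\<in>S 1. F = {x \<in> S k. z \<subseteq> x}"
      then obtain z where z: "z \<in> S 1" "F = {x \<in> S k. z \<subseteq> x}" by blast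
      have "G = {x \<in> S l. z \<subseteq> x}"
        by (rule partner_of_pencil[OF k(1) l(1) kl z(1) G c(2)]) (use cross z in auto)
      then show ?thesis using z by blast
    next
      assume "n = 2 * k \<and> (\<exists>z\<in>S (2 * k - 1). F = {x \<in> S k. x \<subseteq> z})"
      then obtain z where z: "n = 2 * k" "z \<in> S (2 * k - 1)" "F = {x \<in> S k. x \<subseteq> z}" by blast
      have "G \<noteq> {}" using c pos by auto
      then have "l = k \<and> G = {x \<in> S k. x \<subseteq> z}"
        by (intro partner_of_hyperplane[OF k(1) z(1) l(2) z(2) G _ c(2)]) (use cross z in auto)
      then show ?thesis using z by blast
    qed
  next
    assume "?P \<or> ?H"
    then show ?L
    proof
      assume ?P
      then show ?L using card_above k(1) l(1) by auto
    next
      assume ?H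
      moreover from this have "k = l" by simp
      ultimately show ?L using card_inside_hyperplane k(1) by auto
    qed
  qed
qed

end

theorem theorem1p1:
  fixes scale :: "'k::{field,finite} \<Rightarrow> 'v::ab_group_add \<Rightarrow> 'v"
    and q n k l :: nat
    and F G :: "'v set set"
  assumes "q = CARD('k)"
    and "vector_space scale"
    and "vector_space.dim scale (UNIV :: 'v set) = n"
    and "1 \<le> k" and "1 \<le> l"
    and "n \<ge> 2 * k" and "n \<ge> 2 * l"
    and "F \<subseteq> subspaces_of_dim scale k"
    and "G \<subseteq> subspaces_of_dim scale l"
    and "\<And>x y. x \<in> F \<Longrightarrow> y \<in> G \<Longrightarrow> x \<inter> y \<noteq> {0}"
  shows "real (card F) * real (card G)
           \<le> gauss_coeff q (n - 1) (k - 1) * gauss_coeff q (n - 1) (l - 1)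
       \<and> (real (card F) * real (card G)
           = gauss_coeff q (n - 1) (k - 1) * gauss_coeff q (n - 1) (l - 1)
         \<longleftrightarrow>
           (\<exists>z \<in> subspaces_of_dim scale 1.
              F = {x \<in> subspaces_of_dim scale k. z \<subseteq> x} \<and>
              G = {x \<in> subspaces_of_dim scale l. z \<subseteq> x})
         \<or> (n = 2 * k \<and> n = 2 * l \<and>
            (\<exists>z \<in> subspaces_of_dim scale (2 * k - 1).
              F = {x \<in> subspaces_of_dim scale k. x \<subseteq> z} \<and>
              G = {x \<in> subspaces_of_dim scale k. x \<subseteq> z})))"
proof -
  interpret vector_space scale by (rule assms(2))
  have "0 < n" using assms(4,6) by simp
  obtain B where B: "B \<subseteq> UNIV" "independent B" "UNIV \<subseteq> span B" "card B = dim (UNIV :: 'v set)"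
    using basis_exists by blast
  \<comment> \<open>An infinite basis would have \<open>card B = 0\<close>, contrary to
    \<open>n > 0\<close>.\<close>
  then have "finite B" using assms(3) \<open>0 < n\<close> by (metis card.infinite less_irrefl)
  with B interpret finite_field_space scale B q n
    using assms(1,3) by unfold_locales auto
  have "gauss_coeff q (n - 1) (k - 1) = qcount q n 0 1 k" "gauss_coeff q (n - 1) (l - 1) = qcount q n 0 1 l"
    using assms(4-7) by (auto simp only: intro!: gauss_coeff_qcount[OF q_gt_1])
  then show ?thesis
    using cross_intersecting[OF assms(4,6,5,7,8,9,10)] by (simp only: simp_thms)
qed

end
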